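(* Let $A$, $B$ and $Y$ be $k$-spaces, with $B$ weak Hausdorff, and let $q:Y\to B$ be a Hurewicz fibration with a section $t:B\to Y$ that is a closed cofibration. If $f:A\to B$ is a continuous map, then the projection $f^{\ast}q:Y\sqcap A\to A$ is a Hurewicz fibration, and its section $\sigma:A\to Y\sqcap A$, $\sigma(a)=(t(f(a)),a)$, is a closed cofibration.
   Context: A topological space $X$ is a $k$-space if it has the final topology relative to all continuous maps $C\to X$ from compact Hausdorff spaces $C$; $kX$ denotes the set $X$ retopologized with this final topology. All spaces are $k$-spaces and all constructions are $k$-ified: $X\times Y$ means $k$ of the usual product, and the pullback $Y\sqcap A=\{(y,a): q(y)=f(a)\}$ has the $k$-ification of the subspace topology; $f^{\ast}q(y,a)=a$. $B$ is weak Hausdorff if its diagonal is closed in the ($k$-ified) product $B\times B$. A Hurewicz fibration is a map of $k$-spaces with the covering homotopy property relative to all $k$-spaces. A closed cofibration is a map that is a homeomorphism onto a closed subspace and has the homotopy extension property with respect to all ($k$-)spaces. *)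

theory Defs
  imports "HOL-Analysis.Analysis"
begin

section \<open>k-spaces\<close>

text \<open>
  The k-ification of a space on \<open>'a\<close> is the final topology for \<^emph>\<open>all\<close> continuous maps out of compact
  Hausdorff spaces. HOL cannot quantify over types inside a definition, so the test spaces are
  taken on one type that is large enough: the fact \<open>kify_test\<close> below proves that a set passing
  these tests passes those by compact Hausdorff spaces on an arbitrary type.

  The constant \<^const>\<open>k_space\<close> of HOL-Analysis tests with compact subsets instead, which is a
  different notion for non-Hausdorff spaces.
\<close>

type_synonym 'a ktest = "(nat + 'a) set set set set"

definition kify :: "'a topology \<Rightarrow> 'a topology" where
  "kify X = topology (\<lambda>U. U \<subseteq> topspace X \<and>
     (\<forall>(C :: 'a ktest topology) g.
        compact_space C \<and> Hausdorff_space C \<and> continuous_map C X g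
          \<longrightarrow> openin C {x \<in> topspace C. g x \<in> U}))"

definition kspace :: "'a topology \<Rightarrow> bool" where
  "kspace X \<longleftrightarrow> kify X = X"

lemma openin_kify:
  fixes X :: "'a topology"
  shows "openin (kify X) U \<longleftrightarrow> U \<subseteq> topspace X \<and>
     (\<forall>(C :: 'a ktest topology) g.
        compact_space C \<and> Hausdorff_space C \<and> continuous_map C X g
          \<longrightarrow> openin C {x \<in> topspace C. g x \<in> U})"
proof -
  let ?P = "\<lambda>U. U \<subseteq> topspace X \<and>
     (\<forall>(C :: 'a ktest topology) g.
        compact_space C \<and> Hausdorff_space C \<and> continuous_map C X g
          \<longrightarrow> openin C {x \<in> topspace C. g x \<in> U})"
  have "istopology ?P"
    unfolding istopology_def
  proof (intro conjI allI impI)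
    fix S T assume S: "?P S" and T: "?P T"
    show "S \<inter> T \<subseteq> topspace X" using S by blast
    fix C :: "'a ktest topology" and g
    assume *: "compact_space C \<and> Hausdorff_space C \<and> continuous_map C X g"
    have "{x \<in> topspace C. g x \<in> S \<inter> T} = {x \<in> topspace C. g x \<in> S} \<inter> {x \<in> topspace C. g x \<in> T}"
      by auto
    then show "openin C {x \<in> topspace C. g x \<in> S \<inter> T}"
      using S T * by (simp add: openin_Int)
  next
    fix \<K> assume K: "\<forall>K\<in>\<K>. ?P K"
    show "\<Union>\<K> \<subseteq> topspace X" using K by blast
    fix C :: "'a ktest topology" and g
    assume *: "compact_space C \<and> Hausdorff_space C \<and> continuous_map C X g"
    have "{x \<in> topspace C. g x \<in> \<Union>\<K>} = \<Union> ((\<lambda>K. {x \<in> topspace C. g x \<in> K}) ` \<K>)"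
      by auto
    moreover have "openin C \<dots>"
      using K * by (intro openin_Union) auto
    ultimately show "openin C {x \<in> topspace C. g x \<in> \<Union>\<K>}"
      by simp
  qed
  then show ?thesis
    by (simp add: kify_def)
qed

lemma openin_imp_openin_kify: "openin X U \<Longrightarrow> openin (kify X) U"
  unfolding openin_kify by (auto simp: openin_subset openin_continuous_map_preimage)

lemma topspace_kify [simp]: "topspace (kify X) = topspace X"
  by (metis openin_imp_openin_kify openin_kify openin_subset openin_topspace subset_antisym)

lemma kify_test_transport:
  fixes X :: "'a topology" and C :: "'c topology" and j :: "'c \<Rightarrow> 'a ktest"
  assumes j: "inj_on j (topspace C)"
    and C: "compact_space C" "Hausdorff_space C" and g: "continuous_map C X g"
    and U: "openin (kify X) U"
  shows "openin C {x \<in> topspace C. g x \<in> U}"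
proof -
  define i where "i = inv_into (topspace C) j"
  define C' where "C' = pullback_topology (j ` topspace C) i C"
  have ij: "i (j x) = x" if "x \<in> topspace C" for x
    using j that by (simp add: i_def)
  have top: "topspace C' = j ` topspace C"
    using ij by (auto simp: C'_def topspace_pullback_topology)
  have hom: "homeomorphic_maps C C' j i"
    unfolding homeomorphic_maps_def
  proof (intro conjI)
    show "continuous_map C C' j"
      unfolding continuous_map_def
    proof (intro conjI allI impI)
      show "j \<in> topspace C \<rightarrow> topspace C'" using top by auto
      fix W assume "openin C' W"
      then obtain V where V: "openin C V" "W = i -` V \<inter> j ` topspace C"
        by (auto simp: C'_def openin_pullback_topology)
      then have "{x \<in> topspace C. j x \<in> W} = V"
        using ij openin_subset[OF V(1)] by auto
      then show "openin C {x \<in> topspace C. j x \<in> W}" using V by simp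
    qed
    show "continuous_map C' C i"
      using continuous_map_pullback[OF continuous_map_id, of _ i C] by (simp add: C'_def)
  qed (use ij top in auto)
  then have hs: "C homeomorphic_space C'"
    by (auto simp: homeomorphic_space_def)
  have "compact_space C'" "Hausdorff_space C'"
    using C hs homeomorphic_compact_space homeomorphic_Hausdorff_space by blast+
  moreover have "continuous_map C' X (g \<circ> i)"
    using hom g by (auto simp: homeomorphic_maps_def intro: continuous_map_compose)
  ultimately have "openin C' {x \<in> topspace C'. (g \<circ> i) x \<in> U}"
    using U unfolding openin_kify by blast
  then have "openin C {x \<in> topspace C. j x \<in> {x \<in> topspace C'. (g \<circ> i) x \<in> U}}"
    using hom unfolding homeomorphic_maps_def by (blast intro: openin_continuous_map_preimage)
  moreover have "{x \<in> topspace C. j x \<in> {x \<in> topspace C'. (g \<circ> i) x \<in> U}} = {x \<in> topspace C. g x \<in> U}"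
    using ij top by auto
  ultimately show ?thesis by simp
qed

theorem kify_test:
  fixes X :: "'a topology" and C :: "'c topology"
  assumes C: "compact_space C" "Hausdorff_space C" and g: "continuous_map C X g"
    and U: "openin (kify X) U"
  shows "openin C {x \<in> topspace C. g x \<in> U}"
proof (rule ccontr)
  assume not: "\<not> openin C {x \<in> topspace C. g x \<in> U}"
  then obtain c where c: "c \<in> topspace C" "g c \<in> U"
    and c_lim: "\<And>W. openin C W \<Longrightarrow> c \<in> W \<Longrightarrow> \<exists>s\<in>W. g s \<notin> U"
    by (smt (verit, best) mem_Collect_eq openin_subopen openin_subset subset_iff)
  define \<N> where "\<N> = {V. openin X V \<and> g c \<in> V}"
  have "\<exists>M N. openin C M \<and> closedin C N \<and> c \<in> M \<and> M \<subseteq> N \<and> N \<subseteq> {x \<in> topspace C. g x \<in> V}"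
    if "V \<in> \<N>" for V
  proof -
    have "neighbourhood_base_of (closedin C) C"
      using C by (simp add: neighbourhood_base_of_closedin compact_Hausdorff_imp_regular_space)
    moreover have "openin C {x \<in> topspace C. g x \<in> V}"
      using that g by (auto simp: \<N>_def intro: openin_continuous_map_preimage)
    ultimately show ?thesis
      using that c by (auto simp: \<N>_def neighbourhood_base_of)
  qed
  then obtain M N where MN: "\<And>V. V \<in> \<N> \<Longrightarrow> openin C (M V) \<and> closedin C (N V) \<and> c \<in> M V \<and>
      M V \<subseteq> N V \<and> N V \<subseteq> {x \<in> topspace C. g x \<in> V}"
    by metis
  define G where "G = topspace C \<inter> \<Inter> (N ` \<N>)"
  have Gsub: "G \<subseteq> {x \<in> topspace C. g x \<in> V}" if "V \<in> \<N>" for V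
    using MN[OF that] that by (auto simp: G_def)
  have Gclosed: "closedin C G"
  proof -
    have "G = \<Inter> (insert (topspace C) (N ` \<N>))" by (auto simp: G_def)
    moreover have "closedin C (\<Inter> (insert (topspace C) (N ` \<N>)))"
      using MN by (intro closedin_Inter) auto
    ultimately show ?thesis by simp
  qed
  show False
  proof (cases "\<exists>s\<in>G. g s \<notin> U")
    case True
    then obtain s where s: "s \<in> G" "g s \<notin> U" by blast
    define K where "K = Alexandroff_compactification (discrete_topology (UNIV :: nat set))"
    define h where "h = (\<lambda>z :: nat option. if z = None then g c else g s)"
    have sC: "s \<in> topspace C" using s by (auto simp: G_def)
    have topK: "topspace K = UNIV"
      by (auto simp: K_def) (metis UNIV_I image_eqI not_Some_eq)
    have "continuous_map K X h"
      unfolding continuous_map_def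
    proof (intro conjI allI impI)
      show "h \<in> topspace K \<rightarrow> topspace X"
        using g c sC by (auto simp: h_def continuous_map_def)
      fix V assume V: "openin X V"
      consider "V \<in> \<N>" | "g c \<notin> V" using V by (auto simp: \<N>_def)
      then show "openin K {x \<in> topspace K. h x \<in> V}"
      proof cases
        case 1
        then have "{x \<in> topspace K. h x \<in> V} = topspace K"
          using Gsub[OF 1] s by (auto simp: h_def \<N>_def)
        then show ?thesis by simp
      next
        case 2
        then have "{x \<in> topspace K. h x \<in> V} = Some ` {n. g s \<in> V}"
          by (auto simp: h_def topK image_iff split: if_splits)
        then show ?thesis by (simp add: K_def)
      qed
    qed
    moreover have "compact_space K" "Hausdorff_space K"
      by (auto simp: K_def Hausdorff_space_Alexandroff_compactification
            locally_compact_space_discrete_topology)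
    moreover have "inj_on (\<lambda>z. {{{{Inl (case z of None \<Rightarrow> 0 | Some n \<Rightarrow> Suc n)}}}} :: 'a ktest) (topspace K)"
      by (auto simp: inj_on_def split: option.splits)
    ultimately have "openin K {x \<in> topspace K. h x \<in> U}"
      using kify_test_transport U by blast
    moreover have "{x \<in> topspace K. h x \<in> U} = {None}"
      using c s by (auto simp: h_def topK)
    ultimately have "openin K {None}" by simp
    then obtain Q where "compactin (discrete_topology (UNIV :: nat set)) Q"
        "{None} = insert None (Some ` (UNIV - Q))"
      by (auto simp: K_def openin_Alexandroff_compactification)
    then have "finite Q" "Q = UNIV"
      by (auto simp: compactin_discrete_topology)
    then show False by simp
  next
    case False
    have "\<exists>s. s \<in> topspace C \<and> g s \<notin> U \<and> (\<forall>V\<in>\<V>. s \<in> N V)"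
      if "finite \<V>" "\<V> \<subseteq> \<N>" for \<V>
    proof -
      have "openin C (\<Inter> (insert (topspace C) (M ` \<V>)))"
        using that MN by (intro openin_Inter) auto
      moreover have "c \<in> \<Inter> (insert (topspace C) (M ` \<V>))"
        using that MN c by auto
      ultimately obtain s where "s \<in> \<Inter> (insert (topspace C) (M ` \<V>))" "g s \<notin> U"
        using c_lim by blast
      then show ?thesis using that MN by blast
    qed
    then obtain s where s: "\<And>\<V>. finite \<V> \<Longrightarrow> \<V> \<subseteq> \<N> \<Longrightarrow>
        s \<V> \<in> topspace C \<and> g (s \<V>) \<notin> U \<and> (\<forall>V\<in>\<V>. s \<V> \<in> N V)"
      by metis
    define I where "I = {\<V>. finite \<V> \<and> \<V> \<subseteq> \<N>}"
    define E where "E = C closure_of (s ` I)"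
    have sI: "s ` I \<subseteq> topspace C" using s by (auto simp: I_def)
    have sE: "s ` I \<subseteq> E" using sI by (simp add: E_def closure_of_subset)
    have Esub: "E \<subseteq> topspace C" by (simp add: E_def closure_of_subset_topspace)
    have Eclosed: "closedin C E" by (simp add: E_def)
    define L where "L = subtopology C (E - G)"
    define K where "K = Alexandroff_compactification L"
    define h where "h = (\<lambda>z. case z of None \<Rightarrow> g c | Some x \<Rightarrow> g x)"
    have topL: "topspace L = E - G" using Esub by (auto simp: L_def)
    have topK: "topspace K = insert None (Some ` (E - G))" by (simp add: K_def topL)
    have L: "Hausdorff_space L" "locally_compact_space L"
    proof -
      show "Hausdorff_space L" using C by (simp add: L_def Hausdorff_space_subtopology)
      have "locally_compact_space (subtopology C E)"
        using C Eclosed by (metis closedin_compact_space compactin_subspace compact_imp_locally_compact_space)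
      moreover have "openin (subtopology C E) (E - G)"
        using Gclosed Esub by (metis Diff_eq Diff_Int_distrib2 openin_subtopology_Int2 closedin_def
             Int_Diff inf.absorb_iff1 openin_diff openin_topspace)
      ultimately have "locally_compact_space (subtopology (subtopology C E) (E - G))"
        using C by (blast intro: locally_compact_space_open_subset Hausdorff_space_subtopology)
      moreover have "subtopology (subtopology C E) (E - G) = L"
        by (simp add: L_def subtopology_subtopology Int_absorb1)
      ultimately show "locally_compact_space L" by simp
    qed
    have gL: "continuous_map L X g"
      using g by (simp add: L_def continuous_map_from_subtopology)
    have "continuous_map K X h"
      unfolding continuous_map_def
    proof (intro conjI allI impI)
      show "h \<in> topspace K \<rightarrow> topspace X"
        using g c Esub by (auto simp: h_def continuous_map_def topK)
      fix V assume V: "openin X V"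
      consider "V \<in> \<N>" | "g c \<notin> V" using V by (auto simp: \<N>_def)
      then show "openin K {x \<in> topspace K. h x \<in> V}"
      proof cases
        case 1
        define Q where "Q = E - {x \<in> topspace C. g x \<in> V}"
        have QG: "Q \<subseteq> E - G" using Gsub[OF 1] by (auto simp: Q_def)
        have Q: "closedin C Q"
          using Eclosed V g by (auto simp: Q_def intro!: closedin_diff openin_continuous_map_preimage)
        then have "compactin C Q" using C by (simp add: closedin_compact_space)
        then have "compactin L Q" using QG by (simp add: L_def compactin_subtopology)
        moreover have "closedin L Q"
          using Q QG by (metis L_def closedin_subset_topspace)
        moreover have "{x \<in> topspace K. h x \<in> V} = insert None (Some ` (topspace L - Q))"
          using 1 Esub by (auto simp: h_def topK topL Q_def \<N>_def)
        ultimately show ?thesis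
          unfolding K_def openin_Alexandroff_compactification by blast
      next
        case 2
        then have "{x \<in> topspace K. h x \<in> V} = Some ` {x \<in> topspace L. g x \<in> V}"
          by (auto simp: h_def topK topL)
        moreover have "openin L {x \<in> topspace L. g x \<in> V}"
          using V gL by (rule openin_continuous_map_preimage[rotated])
        ultimately show ?thesis by (simp add: K_def)
      qed
    qed
    moreover have "compact_space K" "Hausdorff_space K"
      using L by (auto simp: K_def Hausdorff_space_Alexandroff_compactification)
    moreover have "\<exists>j :: _ \<Rightarrow> 'a ktest. inj_on j (topspace K)"
    proof -
      define code where "code = (\<lambda>x. {{\<V> \<in> I. s \<V> \<in> W} | W. openin C W \<and> x \<in> W})"
      have ne: "code x \<noteq> {}" if "x \<in> E" for x
        using that Esub openin_topspace[of C] by (auto simp: code_def)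
      have inj: "x = y" if xy: "x \<in> E" "y \<in> E" "code x = code y" for x y
      proof (rule ccontr)
        assume "x \<noteq> y"
        then obtain W W' where W: "openin C W" "openin C W'" "x \<in> W" "y \<in> W'" "disjnt W W'"
          using C(2) xy(1,2) Esub unfolding Hausdorff_space_def by (meson subsetD)
        then have "{\<V> \<in> I. s \<V> \<in> W} \<in> code x" unfolding code_def by blast
        then have "{\<V> \<in> I. s \<V> \<in> W} \<in> code y" using xy(3) by simp
        then obtain W2 where W2: "openin C W2" "y \<in> W2" "{\<V> \<in> I. s \<V> \<in> W} = {\<V> \<in> I. s \<V> \<in> W2}"
          unfolding code_def by blast
        have "openin C (W2 \<inter> W')" "y \<in> W2 \<inter> W'" using W W2 by auto
        then obtain \<V> where "\<V> \<in> I" "s \<V> \<in> W2 \<inter> W'"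
          using xy(2) unfolding E_def in_closure_of by blast
        then show False using W W2 by (auto simp: disjnt_iff)
      qed
      define r :: "'a set set set set \<Rightarrow> 'a ktest" where "r = image (image (image (image Inr)))"
      have "inj r"
        by (simp add: r_def inj_def inj_image_eq_iff)
      moreover have "inj_on (\<lambda>z. case z of None \<Rightarrow> {} | Some x \<Rightarrow> code x) (topspace K)"
        unfolding topK
      proof (rule inj_onI)
        fix z w assume "z \<in> insert None (Some ` (E - G))" "w \<in> insert None (Some ` (E - G))"
          and "(case z of None \<Rightarrow> {} | Some x \<Rightarrow> code x) = (case w of None \<Rightarrow> {} | Some x \<Rightarrow> code x)"
        then show "z = w"
          using ne inj by (cases z; cases w) (auto; metis)+
      qed
      ultimately have "inj_on (r \<circ> (\<lambda>z. case z of None \<Rightarrow> {} | Some x \<Rightarrow> code x)) (topspace K)"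
        by (meson comp_inj_on inj_on_subset subset_UNIV)
      then show ?thesis by blast
    qed
    ultimately have "openin K {x \<in> topspace K. h x \<in> U}"
      using kify_test_transport U by blast
    moreover have "None \<in> {x \<in> topspace K. h x \<in> U}"
      using c by (simp add: topK h_def)
    ultimately obtain Q where Q: "compactin L Q"
        "{x \<in> topspace K. h x \<in> U} = insert None (Some ` (topspace L - Q))"
      by (auto simp: K_def openin_Alexandroff_compactification)
    have QG: "Q \<subseteq> E - G" and "closedin C Q"
      using Q(1) C(2) by (auto simp: L_def compactin_subtopology compactin_imp_closedin)
    moreover have "s ` I \<subseteq> Q"
    proof clarify
      fix \<V> assume V: "\<V> \<in> I"
      then have "g (s \<V>) \<notin> U" "s \<V> \<in> topspace C" using s by (auto simp: I_def)
      moreover from this have "s \<V> \<in> E - G" using V sE False by auto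
      ultimately have "Some (s \<V>) \<in> topspace K" "Some (s \<V>) \<notin> {x \<in> topspace K. h x \<in> U}"
        by (auto simp: topK h_def)
      then show "s \<V> \<in> Q" unfolding Q(2) using \<open>s \<V> \<in> E - G\<close> topL by auto
    qed
    ultimately have "E \<subseteq> Q" unfolding E_def by (simp add: closure_of_minimal)
    then have "E \<inter> G = {}" using QG by blast
    moreover have "\<Inter> (insert E (N ` \<N>)) \<noteq> {}"
    proof -
      have "\<Inter>\<F> \<noteq> {}" if F: "finite \<F>" "\<F> \<subseteq> insert E (N ` \<N>)" for \<F>
      proof -
        have "finite (\<F> - {E})" "\<F> - {E} \<subseteq> N ` \<N>" using F by auto
        then obtain \<V> where "finite \<V>" "\<V> \<subseteq> \<N>" "\<F> - {E} = N ` \<V>"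
          by (meson finite_subset_image)
        moreover from this have "s \<V> \<in> E" "\<forall>V\<in>\<V>. s \<V> \<in> N V"
          using s[of \<V>] sE unfolding I_def by blast+
        ultimately have "s \<V> \<in> D" if "D \<in> \<F>" for D
          using that by (cases "D = E") blast+
        then show ?thesis by blast
      qed
      moreover have "\<forall>D \<in> insert E (N ` \<N>). closedin C D" using Eclosed MN by auto
      ultimately show ?thesis
        using C(1)[unfolded compact_space_fip, rule_format, of "insert E (N ` \<N>)"] by simp
    qed
    moreover have "\<Inter> (insert E (N ` \<N>)) \<subseteq> E \<inter> G"
      using Esub by (auto simp: G_def)
    ultimately show False by blast
  qed
qed

section \<open>k-ified constructions\<close>

definition kprod :: "'a topology \<Rightarrow> 'b topology \<Rightarrow> ('a \<times> 'b) topology" where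
  "kprod X Y = kify (prod_topology X Y)"

definition pullback_space ::
    "'y topology \<Rightarrow> 'a topology \<Rightarrow> ('y \<Rightarrow> 'b) \<Rightarrow> ('a \<Rightarrow> 'b) \<Rightarrow> ('y \<times> 'a) topology" where
  "pullback_space Y A q f =
     kify (subtopology (kprod Y A) {(y, a). y \<in> topspace Y \<and> a \<in> topspace A \<and> q y = f a})"

definition weak_Hausdorff :: "'b topology \<Rightarrow> bool" where
  "weak_Hausdorff B \<longleftrightarrow> closedin (kprod B B) {(b, b) | b. b \<in> topspace B}"

section \<open>Fibrations and cofibrations\<close>

abbreviation unit_interval :: "real topology" where
  "unit_interval \<equiv> top_of_set {0..1}"

text \<open>
  Both notions quantify over all k-spaces \<open>Z\<close>; the type carrying \<open>Z\<close> is a parameter. Asserting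
  them with a free type variable \<open>'z\<close> means: for all k-spaces whatsoever. As hypotheses they are
  used at the type carrying the universal test space, to which every other one reduces:
  for the covering homotopy property of \<open>q : Y \<rightarrow> B\<close> the space of pairs \<open>(y, \<gamma>)\<close> with \<open>\<gamma>\<close> a path in
  \<open>B\<close> starting at \<open>q y\<close>, on \<open>'y \<times> (real \<Rightarrow> 'b)\<close>; for the homotopy extension property of
  \<open>i : B \<rightarrow> Y\<close> the mapping cylinder of \<open>i\<close>, on \<open>'y + 'b \<times> real\<close>.
\<close>

definition hurewicz_fibration ::
    "'z itself \<Rightarrow> 'y topology \<Rightarrow> 'b topology \<Rightarrow> ('y \<Rightarrow> 'b) \<Rightarrow> bool" where
  "hurewicz_fibration T Y B q \<longleftrightarrow>
     kspace Y \<and> kspace B \<and> continuous_map Y B q \<and>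
     (\<forall>(Z :: 'z topology) h H.
        kspace Z \<and> continuous_map Z Y h \<and> continuous_map (kprod Z unit_interval) B H \<and>
        (\<forall>z \<in> topspace Z. H (z, 0) = q (h z)) \<longrightarrow>
        (\<exists>G. continuous_map (kprod Z unit_interval) Y G \<and>
             (\<forall>z \<in> topspace Z. G (z, 0) = h z) \<and>
             (\<forall>z \<in> topspace Z. \<forall>s \<in> {0..1}. q (G (z, s)) = H (z, s))))"

definition closed_cofibration ::
    "'z itself \<Rightarrow> 'b topology \<Rightarrow> 'y topology \<Rightarrow> ('b \<Rightarrow> 'y) \<Rightarrow> bool" where
  "closed_cofibration T B Y i \<longleftrightarrow>
     kspace B \<and> kspace Y \<and> embedding_map B Y i \<and> closedin Y (i ` topspace B) \<and>
     (\<forall>(Z :: 'z topology) h H.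
        kspace Z \<and> continuous_map Y Z h \<and> continuous_map (kprod B unit_interval) Z H \<and>
        (\<forall>b \<in> topspace B. H (b, 0) = h (i b)) \<longrightarrow>
        (\<exists>G. continuous_map (kprod Y unit_interval) Z G \<and>
             (\<forall>y \<in> topspace Y. G (y, 0) = h y) \<and>
             (\<forall>b \<in> topspace B. \<forall>s \<in> {0..1}. G (i b, s) = H (b, s))))"

end

theory Submission
  imports Defs
begin

text \<open>
  A section \<open>t\<close> with closed image is a cofibration iff \<open>Y \<times> I\<close> retracts onto the mapping cylinder
  \<open>M = Y \<times> 0 \<union> t B \<times> I\<close>. A retraction that preserves the fibres of \<open>q\<close> can be pulled back along
  \<open>f\<close>, so the point is to make it fibrewise. Any retraction yields a deformation \<open>h\<close> of \<open>Y\<close> and a map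
  \<open>u : Y \<rightarrow> I\<close> vanishing on \<open>t B\<close>, such that \<open>h (y, u y)\<close> lies in \<open>t B\<close> whenever \<open>u y < 1\<close>. Stopping
  \<open>h\<close> at the time \<open>L = min s (u y)\<close> gives the map \<open>(y, s) \<mapsto> (h (y, L), s - L)\<close> into \<open>M\<close>, and
  running \<open>h\<close> backwards from there gives a homotopy of its projection to \<open>B\<close> that is back at \<open>q y\<close>
  at time \<open>L\<close>. Now \<open>M \<rightarrow> B\<close> has the covering homotopy property too: a point of \<open>t B\<close> follows \<open>t\<close>
  over the homotopy while its height drops at unit speed, and once the height is \<open>0\<close> the covering
  homotopy property of \<open>q\<close> takes over. The lifted homotopy at time \<open>L\<close> is the fibrewise retraction;
  it fixes \<open>M\<close> because \<open>L = 0\<close> there.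
\<close>

section \<open>Products with compact spaces\<close>

lemma continuous_map_compose2:
  "continuous_map Y Z g \<Longrightarrow> continuous_map X Y f \<Longrightarrow> continuous_map X Z (\<lambda>x. g (f x))"
  using continuous_map_compose[of X Y f Z g] by (simp add: o_def)

lemma continuous_map_cases_closed:
  assumes "closedin X S" "closedin X T" "topspace X \<subseteq> S \<union> T"
    and f: "continuous_map (subtopology X S) Y f" and g: "continuous_map (subtopology X T) Y g"
    and fg: "\<And>x. x \<in> S \<Longrightarrow> x \<in> T \<Longrightarrow> f x = g x"
  shows "continuous_map X Y (\<lambda>x. if x \<in> S then f x else g x)"
proof (rule pasting_lemma_closed[where I = UNIV and T = "\<lambda>b. if b then S else T"
      and f = "\<lambda>b. if b then f else g"])
  show "\<exists>b. b \<in> UNIV \<and> x \<in> (if b then S else T) \<and>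
      (if x \<in> S then f x else g x) = (if b then f else g) x" if "x \<in> topspace X" for x
    using that assms(3) by (cases "x \<in> S") (auto intro: exI[of _ True] exI[of _ False])
qed (use assms in \<open>auto split: if_splits\<close>)

lemma continuous_map_slice_right:
  "continuous_map (prod_topology X Y) Z f \<Longrightarrow> x \<in> topspace X \<Longrightarrow> continuous_map Y Z (\<lambda>y. f (x, y))"
  by (rule continuous_map_compose2) (auto intro!: continuous_map_pairedI)

lemma continuous_map_slice_left:
  "continuous_map (prod_topology X Y) Z f \<Longrightarrow> y \<in> topspace Y \<Longrightarrow> continuous_map X Z (\<lambda>x. f (x, y))"
  by (rule continuous_map_compose2) (auto intro!: continuous_map_pairedI)

lemma openin_Collect_ball_compactin:
  assumes W: "openin (prod_topology X Y) W" and K: "compactin Y K"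
  shows "openin X {x \<in> topspace X. \<forall>y\<in>K. (x, y) \<in> W}"
proof (subst openin_subopen, rule ballI)
  fix x assume "x \<in> {x \<in> topspace X. \<forall>y\<in>K. (x, y) \<in> W}"
  then have x: "x \<in> topspace X" "{x} \<times> K \<subseteq> W" by auto
  obtain U V where "openin X U" "openin Y V" "x \<in> U" "K \<subseteq> V" "U \<times> V \<subseteq> W"
    using tube_lemma_right[OF W K x] by blast
  then show "\<exists>T. openin X T \<and> x \<in> T \<and> T \<subseteq> {x \<in> topspace X. \<forall>y\<in>K. (x, y) \<in> W}"
    using openin_subset by (intro exI[of _ U] conjI subsetI CollectI ballI) blast+
qed

lemma locally_compact_Hausdorff_compact_neighbourhood:
  assumes "locally_compact_space X" "Hausdorff_space X" "openin X W" "x \<in> W"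
  obtains U K where "openin X U" "x \<in> U" "U \<subseteq> K" "compactin X K" "K \<subseteq> W"
  using assms locally_compact_space_neighbourhood_base[of X]
  unfolding neighbourhood_base_of by meson

lemma compact_space_attains_SUP:
  fixes f :: "'a \<Rightarrow> real"
  assumes "compact_space X" "topspace X \<noteq> {}" "continuous_map X euclideanreal f"
  obtains x where "x \<in> topspace X" "(SUP x\<in>topspace X. f x) = f x"
    "\<And>y. y \<in> topspace X \<Longrightarrow> f y \<le> f x"
proof -
  have "compactin euclideanreal (f ` topspace X)"
    using assms by (intro image_compactin) (auto simp: compact_space_def)
  then obtain x where x: "x \<in> topspace X" "\<forall>y\<in>topspace X. f y \<le> f x"
    using compact_attains_sup[of "f ` topspace X"] assms(2) by auto
  moreover have "(SUP x\<in>topspace X. f x) = f x"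
    using x by (intro cSup_eq_maximum) auto
  ultimately show thesis using that by blast
qed

lemma continuous_map_SUP_compact_space:
  fixes f :: "'a \<times> 'b \<Rightarrow> real"
  assumes K: "compact_space K" "topspace K \<noteq> {}"
    and f: "continuous_map (prod_topology X K) euclideanreal f"
  shows "continuous_map X euclideanreal (\<lambda>x. SUP k\<in>topspace K. f (x, k))"
  unfolding continuous_map_upper_lower_semicontinuous_lt
proof (intro conjI allI)
  fix c :: real
  have max: "\<exists>k\<in>topspace K. (SUP k\<in>topspace K. f (x, k)) = f (x, k) \<and>
      (\<forall>k'\<in>topspace K. f (x, k') \<le> f (x, k))" if "x \<in> topspace X" for x
    using compact_space_attains_SUP[OF K continuous_map_slice_right[OF f that]] by metis
  have "openin X {x \<in> topspace X. f (x, k) \<in> {c<..}}" if "k \<in> topspace K" for k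
    using continuous_map_slice_left[OF f that] by (rule openin_continuous_map_preimage) simp
  then have "openin X (\<Union>k\<in>topspace K. {x \<in> topspace X. f (x, k) \<in> {c<..}})"
    by blast
  also have "(\<Union>k\<in>topspace K. {x \<in> topspace X. f (x, k) \<in> {c<..}}) =
      {x \<in> topspace X. c < (SUP k\<in>topspace K. f (x, k))}"
    using max by force
  finally show "openin X {x \<in> topspace X. c < (SUP k\<in>topspace K. f (x, k))}" .
  let ?W = "{z \<in> topspace (prod_topology X K). f z \<in> {..<c}}"
  have "openin (prod_topology X K) ?W"
    using f by (rule openin_continuous_map_preimage) simp
  then have "openin X {x \<in> topspace X. \<forall>k\<in>topspace K. (x, k) \<in> ?W}"
    using K(1) by (intro openin_Collect_ball_compactin) (auto simp: compact_space_def)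
  also have "{x \<in> topspace X. \<forall>k\<in>topspace K. (x, k) \<in> ?W} =
      {x \<in> topspace X. (SUP k\<in>topspace K. f (x, k)) < c}"
    using max by fastforce
  finally show "openin X {x \<in> topspace X. (SUP k\<in>topspace K. f (x, k)) < c}" .
qed

lemma continuous_fibrewise_maximum:
  fixes f :: "'a \<times> 'b \<Rightarrow> real"
  assumes K: "compact_space K" "topspace K \<noteq> {}"
    and f: "continuous_map (prod_topology X K) euclideanreal f"
  obtains u where "continuous_map X euclideanreal u"
    and "\<And>x. x \<in> topspace X \<Longrightarrow> \<exists>k\<in>topspace K. u x = f (x, k)"
    and "\<And>x k. x \<in> topspace X \<Longrightarrow> k \<in> topspace K \<Longrightarrow> f (x, k) \<le> u x"
proof (rule that)
  show "continuous_map X euclideanreal (\<lambda>x. SUP k\<in>topspace K. f (x, k))"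
    using K f by (rule continuous_map_SUP_compact_space)
  fix x assume "x \<in> topspace X"
  from continuous_map_slice_right[OF f this]
  obtain k where k: "k \<in> topspace K" "(SUP k\<in>topspace K. f (x, k)) = f (x, k)"
    and k_max: "\<And>l. l \<in> topspace K \<Longrightarrow> f (x, l) \<le> f (x, k)"
    using compact_space_attains_SUP[OF K] by blast
  show "\<exists>k\<in>topspace K. (SUP k\<in>topspace K. f (x, k)) = f (x, k)"
    using k by blast
  show "f (x, l) \<le> (SUP k\<in>topspace K. f (x, k))" if "l \<in> topspace K" for l
    using k(2) k_max[OF that] by simp
qed

lemma compact_space_unit_interval: "compact_space unit_interval"
  by (simp add: compact_space_subtopology)

lemma Hausdorff_space_unit_interval: "Hausdorff_space unit_interval"
  by (simp add: Hausdorff_space_subtopology)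

lemma locally_compact_space_unit_interval: "locally_compact_space unit_interval"
  by (simp add: compact_imp_locally_compact_space compact_space_unit_interval)

lemma continuous_map_snd_unit_interval:
  "continuous_map (prod_topology X unit_interval) euclideanreal snd"
  using continuous_map_snd[of X unit_interval] by (simp add: continuous_map_in_subtopology)

lemma continuous_map_unit_interval_iff:
  "continuous_map X unit_interval f \<longleftrightarrow>
    continuous_map X euclideanreal f \<and> (\<forall>x\<in>topspace X. 0 \<le> f x \<and> f x \<le> 1)"
  by (auto simp: continuous_map_in_subtopology)

lemma continuous_map_unit_interval_min:
  assumes "continuous_map X unit_interval f" "continuous_map X unit_interval g"
  shows "continuous_map X unit_interval (\<lambda>x. min (f x) (g x))"
  using assms by (auto simp: continuous_map_unit_interval_iff min_le_iff_disj
      intro!: continuous_map_real_min)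

lemma continuous_map_unit_interval_add:
  assumes "continuous_map X unit_interval f" "continuous_map X unit_interval g"
  shows "continuous_map X unit_interval (\<lambda>x. min 1 (f x + g x))"
  using assms by (auto simp: continuous_map_unit_interval_iff
      intro!: continuous_map_real_min continuous_map_add)

lemma continuous_map_unit_interval_diff:
  assumes "continuous_map X unit_interval f" "continuous_map X unit_interval g"
  shows "continuous_map X unit_interval (\<lambda>x. max 0 (f x - g x))"
  using assms by (fastforce simp: continuous_map_unit_interval_iff
      intro!: continuous_map_real_max continuous_map_diff)

lemma closedin_unit_interval_zero_set:
  assumes "continuous_map X unit_interval f"
  shows "closedin X {x \<in> topspace X. f x = 0}"
  using closedin_continuous_map_preimage[OF assms, of "{0}"] by (simp add: closed_subset)

section \<open>The compact-open topology\<close>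

\<comment> \<open>The values of a function outside \<^term>\<open>topspace X\<close> are arbitrary and not seen by the topology, which
  is therefore not Hausdorff in general.\<close>
definition compact_open_topology :: "'a topology \<Rightarrow> 'b topology \<Rightarrow> ('a \<Rightarrow> 'b) topology" where
  "compact_open_topology X Y = topology_generated_by
     {{f. continuous_map X Y f \<and> f ` K \<subseteq> V} | K V. compactin X K \<and> openin Y V}"

lemma openin_compact_open_topology:
  "compactin X K \<Longrightarrow> openin Y V \<Longrightarrow>
    openin (compact_open_topology X Y) {f. continuous_map X Y f \<and> f ` K \<subseteq> V}"
  unfolding compact_open_topology_def by (rule topology_generated_by_Basis) blast

lemma topspace_compact_open_topology [simp]:
  "topspace (compact_open_topology X Y) = {f. continuous_map X Y f}"
proof
  show "topspace (compact_open_topology X Y) \<subseteq> {f. continuous_map X Y f}"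
    by (auto simp: compact_open_topology_def)
  show "{f. continuous_map X Y f} \<subseteq> topspace (compact_open_topology X Y)"
    using openin_subset[OF openin_compact_open_topology[of X "{}" Y "{}"]] by simp
qed

lemma continuous_map_eval_compact_open:
  assumes "locally_compact_space X" "Hausdorff_space X"
  shows "continuous_map (prod_topology (compact_open_topology X Y) X) Y (\<lambda>(f, x). f x)"
  unfolding continuous_map_def
proof (intro conjI allI impI)
  let ?F = "compact_open_topology X Y"
  show "(\<lambda>(f, x). f x) \<in> topspace (prod_topology ?F X) \<rightarrow> topspace Y"
    by (auto simp: continuous_map_def)
  fix V assume V: "openin Y V"
  let ?W = "{z \<in> topspace (prod_topology ?F X). (case z of (f, x) \<Rightarrow> f x) \<in> V}"
  show "openin (prod_topology ?F X) ?W"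
    unfolding openin_prod_topology_alt
  proof (intro allI impI)
    fix f x assume "(f, x) \<in> ?W"
    then have f: "continuous_map X Y f" and x: "x \<in> topspace X" "f x \<in> V" by auto
    have "openin X {x \<in> topspace X. f x \<in> V}"
      using f V by (rule openin_continuous_map_preimage)
    moreover have "x \<in> {x \<in> topspace X. f x \<in> V}" using x by simp
    ultimately obtain N K where N: "openin X N" "x \<in> N" "N \<subseteq> K"
      and K: "compactin X K" "K \<subseteq> {x \<in> topspace X. f x \<in> V}"
      by (rule locally_compact_Hausdorff_compact_neighbourhood[OF assms])
    let ?N = "{f. continuous_map X Y f \<and> f ` K \<subseteq> V}"
    have "openin ?F ?N" using K(1) V by (rule openin_compact_open_topology)
    moreover have "f \<in> ?N" using f K(2) by auto
    moreover have "?N \<times> N \<subseteq> ?W" using N(3) openin_subset[OF N(1)] by auto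
    ultimately show "\<exists>F N. openin ?F F \<and> openin X N \<and> f \<in> F \<and> x \<in> N \<and> F \<times> N \<subseteq> ?W"
      using N(1,2) by blast
  qed
qed

lemma continuous_map_curry_compact_open:
  assumes H: "continuous_map (prod_topology Z X) Y H"
  shows "continuous_map Z (compact_open_topology X Y) (\<lambda>z x. H (z, x))"
  unfolding compact_open_topology_def
proof (rule continuous_on_generated_topo)
  let ?S = "{{f. continuous_map X Y f \<and> f ` K \<subseteq> V} | K V. compactin X K \<and> openin Y V}"
  have slice: "continuous_map X Y (\<lambda>x. H (z, x))" if "z \<in> topspace Z" for z
    using H that by (rule continuous_map_slice_right)
  show "(\<lambda>z x. H (z, x)) ` topspace Z \<subseteq> \<Union>?S"
    using slice topspace_compact_open_topology[of X Y, unfolded compact_open_topology_def]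
    unfolding topology_generated_by_topspace by blast
  fix U assume "U \<in> ?S"
  then obtain K V where U: "U = {f. continuous_map X Y f \<and> f ` K \<subseteq> V}"
    and K: "compactin X K" and V: "openin Y V"
    by blast
  let ?W = "{w \<in> topspace (prod_topology Z X). H w \<in> V}"
  have "openin (prod_topology Z X) ?W"
    using H V by (rule openin_continuous_map_preimage)
  then have "openin Z {z \<in> topspace Z. \<forall>x\<in>K. (z, x) \<in> ?W}"
    using K by (rule openin_Collect_ball_compactin)
  also have "{z \<in> topspace Z. \<forall>x\<in>K. (z, x) \<in> ?W} = (\<lambda>z x. H (z, x)) -` U \<inter> topspace Z"
    using slice compactin_subset_topspace[OF K] by (auto simp: U)
  finally show "openin Z ((\<lambda>z x. H (z, x)) -` U \<inter> topspace Z)" .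
qed

section \<open>k-spaces\<close>

lemma kspaceI: "(\<And>U. openin (kify X) U \<Longrightarrow> openin X U) \<Longrightarrow> kspace X"
  unfolding kspace_def topology_eq using openin_imp_openin_kify by blast

lemma continuous_map_compact_Hausdorff_kify:
  assumes "compact_space C" "Hausdorff_space C" "continuous_map C X g"
  shows "continuous_map C (kify X) g"
  using assms kify_test[OF assms] by (auto simp: continuous_map_def)

lemma kspace_kify: "kspace (kify (X :: 'a topology))"
proof (rule kspaceI)
  fix U assume U: "openin (kify (kify X)) U"
  show "openin (kify X) U"
    unfolding openin_kify
  proof (intro conjI allI impI)
    show "U \<subseteq> topspace X" using openin_subset[OF U] by simp
    fix C :: "'a ktest topology" and g
    assume "compact_space C \<and> Hausdorff_space C \<and> continuous_map C X g"
    then show "openin C {x \<in> topspace C. g x \<in> U}"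
      using U by (intro kify_test[where X = "kify X"] continuous_map_compact_Hausdorff_kify) auto
  qed
qed

lemma continuous_map_from_kify:
  "continuous_map X Y f \<Longrightarrow> continuous_map (kify X) Y f"
  by (simp add: continuous_map_def openin_imp_openin_kify)

lemma continuous_map_into_kify_iff:
  fixes X :: "'a topology"
  assumes X: "kspace X"
  shows "continuous_map X (kify Y) f \<longleftrightarrow> continuous_map X Y f"
proof
  show "continuous_map X Y f" if "continuous_map X (kify Y) f"
    using that by (simp add: continuous_map_def openin_imp_openin_kify)
next
  assume f: "continuous_map X Y f"
  have "openin (kify X) {x \<in> topspace X. f x \<in> U}" if U: "openin (kify Y) U" for U
    unfolding openin_kify
  proof (intro conjI allI impI)
    fix C :: "'a ktest topology" and g
    assume C: "compact_space C \<and> Hausdorff_space C \<and> continuous_map C X g"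
    then have "openin C {x \<in> topspace C. f (g x) \<in> U}"
      using f U by (intro kify_test[where X = Y]) (auto intro: continuous_map_compose2)
    also have "{x \<in> topspace C. f (g x) \<in> U} = {x \<in> topspace C. g x \<in> {x \<in> topspace X. f x \<in> U}}"
      using C by (auto simp: continuous_map_def)
    finally show "openin C {x \<in> topspace C. g x \<in> {x \<in> topspace X. f x \<in> U}}" .
  qed auto
  then show "continuous_map X (kify Y) f"
    using f X by (simp add: continuous_map_def kspace_def)
qed

lemma kspace_locally_compact_Hausdorff:
  assumes "locally_compact_space X" "Hausdorff_space X"
  shows "kspace X"
proof (rule kspaceI)
  fix U assume U: "openin (kify X) U"
  show "openin X U"
  proof (subst openin_subopen, rule ballI)
    fix x assume x: "x \<in> U"
    then have "x \<in> topspace X" using openin_subset[OF U] by auto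
    then obtain V K where V: "openin X V" "x \<in> V" "V \<subseteq> K" and K: "compactin X K"
      using assms(1) by (auto simp: locally_compact_space_def)
    have "openin (subtopology X K) {x \<in> topspace (subtopology X K). x \<in> U}"
      using K assms(2) U
      by (intro kify_test[where X = X])
        (auto simp: compactin_subspace Hausdorff_space_subtopology continuous_map_from_subtopology)
    then obtain T where "openin X T" "topspace X \<inter> K \<inter> U = T \<inter> K"
      by (auto simp: openin_subtopology)
    then show "\<exists>T. openin X T \<and> x \<in> T \<and> T \<subseteq> U"
      using V x openin_subset[OF U] by (intro exI[of _ "T \<inter> V"]) auto
  qed
qed

lemma openin_kify_Collect_ball_compactin:
  fixes X :: "'a topology" and Y :: "'b topology"
  assumes U: "openin (kify (prod_topology X Y)) U" and K: "compactin Y K" and Y: "Hausdorff_space Y"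
  shows "openin (kify X) {x \<in> topspace X. \<forall>y\<in>K. (x, y) \<in> U}"
  unfolding openin_kify
proof (intro conjI allI impI)
  let ?K = "subtopology Y K" and ?V = "{x \<in> topspace X. \<forall>y\<in>K. (x, y) \<in> U}"
  have topK: "topspace ?K = K" using compactin_subset_topspace[OF K] by auto
  fix C :: "'a ktest topology" and g
  assume C: "compact_space C \<and> Hausdorff_space C \<and> continuous_map C X g"
  let ?W = "{z \<in> topspace (prod_topology C ?K). (g (fst z), snd z) \<in> U}"
  have "openin (prod_topology C ?K) ?W"
  proof (rule kify_test[OF _ _ _ U])
    show "compact_space (prod_topology C ?K)"
      using C K by (simp add: compact_space_prod_topology compact_space_subtopology)
    show "Hausdorff_space (prod_topology C ?K)"
      using C Y by (simp add: Hausdorff_space_prod_topology Hausdorff_space_subtopology)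
    have "continuous_map (prod_topology C ?K) Y snd"
      using continuous_map_snd continuous_map_into_fulltopology by blast
    then show "continuous_map (prod_topology C ?K) (prod_topology X Y) (\<lambda>z. (g (fst z), snd z))"
      using C
      by (auto intro!: continuous_map_pairedI continuous_map_compose2[OF _ continuous_map_fst])
  qed
  moreover have "compactin ?K K"
    using K by (simp add: compactin_subtopology)
  ultimately have "openin C {c \<in> topspace C. \<forall>y\<in>K. (c, y) \<in> ?W}"
    by (rule openin_Collect_ball_compactin)
  also have "{c \<in> topspace C. \<forall>y\<in>K. (c, y) \<in> ?W} = {c \<in> topspace C. g c \<in> ?V}"
    using C topK by (auto simp: continuous_map_def)
  finally show "openin C {c \<in> topspace C. g c \<in> ?V}" .
qed auto

lemma kspace_prod_locally_compact_Hausdorff: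
  assumes X: "kspace X" and Y: "locally_compact_space Y" "Hausdorff_space Y"
  shows "kspace (prod_topology X Y)"
proof (rule kspaceI)
  fix U assume U: "openin (kify (prod_topology X Y)) U"
  show "openin (prod_topology X Y) U"
    unfolding openin_prod_topology_alt
  proof (intro allI impI)
    fix x y assume xy: "(x, y) \<in> U"
    then have x: "x \<in> topspace X" and y: "y \<in> topspace Y" using openin_subset[OF U] by auto
    have "continuous_map Y (kify (prod_topology X Y)) (Pair x)"
      using Y x by (auto simp: continuous_map_into_kify_iff kspace_locally_compact_Hausdorff
          intro!: continuous_map_pairedI)
    then have "openin Y {w \<in> topspace Y. (x, w) \<in> U}"
      using U by (rule openin_continuous_map_preimage)
    moreover have "y \<in> {w \<in> topspace Y. (x, w) \<in> U}" using xy y by simp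
    ultimately obtain N K where N: "openin Y N" "y \<in> N" "N \<subseteq> K"
      and K: "compactin Y K" "K \<subseteq> {w \<in> topspace Y. (x, w) \<in> U}"
      by (rule locally_compact_Hausdorff_compact_neighbourhood[OF Y])
    let ?V = "{z \<in> topspace X. \<forall>w\<in>K. (z, w) \<in> U}"
    have "openin X ?V"
      using openin_kify_Collect_ball_compactin[OF U K(1) Y(2)] X by (simp add: kspace_def)
    moreover have "x \<in> ?V" using x K(2) by auto
    moreover have "?V \<times> N \<subseteq> U" using N(3) by auto
    ultimately show "\<exists>V N. openin X V \<and> openin Y N \<and> x \<in> V \<and> y \<in> N \<and> V \<times> N \<subseteq> U"
      using N(1,2) by blast
  qed
qed

lemma kspace_prod_unit_interval: "kspace X \<Longrightarrow> kspace (prod_topology X unit_interval)"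
  by (intro kspace_prod_locally_compact_Hausdorff locally_compact_space_unit_interval
      Hausdorff_space_unit_interval)

lemma kprod_unit_interval: "kspace X \<Longrightarrow> kprod X unit_interval = prod_topology X unit_interval"
  using kspace_prod_unit_interval by (auto simp: kprod_def kspace_def)

section \<open>Fibrations\<close>

lemma hurewicz_fibrationI:
  fixes Y :: "'y topology" and B :: "'b topology"
  assumes "kspace Y" "kspace B" "continuous_map Y B q"
    and lift: "\<And>(Z :: 'z topology) h H. kspace Z \<Longrightarrow> continuous_map Z Y h \<Longrightarrow>
      continuous_map (prod_topology Z unit_interval) B H \<Longrightarrow>
      (\<And>z. z \<in> topspace Z \<Longrightarrow> H (z, 0) = q (h z)) \<Longrightarrow>
      \<exists>G. continuous_map (prod_topology Z unit_interval) Y G \<and>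
        (\<forall>z\<in>topspace Z. G (z, 0) = h z) \<and>
        (\<forall>z\<in>topspace Z. \<forall>s\<in>{0..1}. q (G (z, s)) = H (z, s))"
  shows "hurewicz_fibration TYPE('z) Y B q"
  unfolding hurewicz_fibration_def
  using assms(1-3) lift by (simp add: kprod_unit_interval cong: conj_cong)

lemma hurewicz_fibration_lift:
  fixes Y :: "'y topology" and B :: "'b topology" and Z :: "'z topology"
  assumes fib: "hurewicz_fibration TYPE('z) Y B q" and Z: "kspace Z"
    and h: "continuous_map Z Y h" and H: "continuous_map (prod_topology Z unit_interval) B H"
    and H0: "\<And>z. z \<in> topspace Z \<Longrightarrow> H (z, 0) = q (h z)"
  obtains G where "continuous_map (prod_topology Z unit_interval) Y G"
    and "\<And>z. z \<in> topspace Z \<Longrightarrow> G (z, 0) = h z"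
    and "\<And>z s. z \<in> topspace Z \<Longrightarrow> s \<in> {0..1} \<Longrightarrow> q (G (z, s)) = H (z, s)"
proof -
  have "kspace Z \<and> continuous_map Z Y h \<and> continuous_map (kprod Z unit_interval) B H \<and>
      (\<forall>z\<in>topspace Z. H (z, 0) = q (h z))"
    using Z h H H0 by (simp add: kprod_unit_interval)
  then show thesis
    using fib that unfolding hurewicz_fibration_def kprod_unit_interval[OF Z, symmetric] by blast
qed

definition mapping_path_space ::
    "'y topology \<Rightarrow> 'b topology \<Rightarrow> ('y \<Rightarrow> 'b) \<Rightarrow> ('y \<times> (real \<Rightarrow> 'b)) topology" where
  "mapping_path_space Y B q = kify (subtopology
     (prod_topology Y (compact_open_topology unit_interval B)) {(y, \<gamma>). \<gamma> 0 = q y})"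

lemma topspace_mapping_path_space:
  "topspace (mapping_path_space Y B q) =
    {(y, \<gamma>). y \<in> topspace Y \<and> continuous_map unit_interval B \<gamma> \<and> \<gamma> 0 = q y}"
  by (auto simp: mapping_path_space_def)

lemma kspace_mapping_path_space: "kspace (mapping_path_space Y B q)"
  by (simp add: mapping_path_space_def kspace_kify)

lemma continuous_map_mapping_path_space_fst: "continuous_map (mapping_path_space Y B q) Y fst"
  unfolding mapping_path_space_def
  by (intro continuous_map_from_kify continuous_map_from_subtopology continuous_map_fst)

lemma continuous_map_mapping_path_space_eval:
  "continuous_map (prod_topology (mapping_path_space Y B q) unit_interval) B (\<lambda>((y, \<gamma>), s). \<gamma> s)"
proof -
  let ?P = "mapping_path_space Y B q" and ?F = "compact_open_topology unit_interval B"
  have "continuous_map ?P ?F snd"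
    unfolding mapping_path_space_def
    by (intro continuous_map_from_kify continuous_map_from_subtopology continuous_map_snd)
  then have "continuous_map (prod_topology ?P unit_interval) (prod_topology ?F unit_interval)
      (\<lambda>z. (snd (fst z), snd z))"
    by (intro continuous_map_pairedI continuous_map_snd
        continuous_map_compose2[OF _ continuous_map_fst])
  from continuous_map_compose2[OF continuous_map_eval_compact_open this]
  show ?thesis
    by (simp add: case_prod_unfold locally_compact_space_unit_interval
        Hausdorff_space_unit_interval)
qed

lemma continuous_map_into_mapping_path_space:
  assumes Z: "kspace Z" and h: "continuous_map Z Y h"
    and H: "continuous_map (prod_topology Z unit_interval) B H"
    and H0: "\<And>z. z \<in> topspace Z \<Longrightarrow> H (z, 0) = q (h z)"
  shows "continuous_map Z (mapping_path_space Y B q) (\<lambda>z. (h z, \<lambda>s. H (z, s)))"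
  unfolding mapping_path_space_def continuous_map_into_kify_iff[OF Z]
  by (intro continuous_map_into_subtopology continuous_map_pairedI h
      continuous_map_curry_compact_open[OF H]) (use H0 in auto)

lemma hurewicz_fibration_all_types:
  fixes Y :: "'y topology" and B :: "'b topology"
  assumes fib: "hurewicz_fibration TYPE('y \<times> (real \<Rightarrow> 'b)) Y B q"
  shows "hurewicz_fibration TYPE('z) Y B q"
proof (rule hurewicz_fibrationI)
  let ?P = "mapping_path_space Y B q" and ?I = unit_interval
  have "(case (p, 0) of ((y, \<gamma>), s) \<Rightarrow> \<gamma> s) = q (fst p)" if "p \<in> topspace ?P" for p
    using that by (auto simp: topspace_mapping_path_space)
  then obtain L where L: "continuous_map (prod_topology ?P ?I) Y L"
    and L0: "\<And>p. p \<in> topspace ?P \<Longrightarrow> L (p, 0) = fst p"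
    and qL: "\<And>p s. p \<in> topspace ?P \<Longrightarrow> s \<in> {0..1} \<Longrightarrow> q (L (p, s)) = snd p s"
    using hurewicz_fibration_lift[OF fib kspace_mapping_path_space
        continuous_map_mapping_path_space_fst continuous_map_mapping_path_space_eval[where q = q]]
    by (smt (verit) case_prod_beta fst_conv snd_conv)
  fix Z :: "'z topology" and h H
  assume Z: "kspace Z" and h: "continuous_map Z Y h"
    and H: "continuous_map (prod_topology Z ?I) B H"
    and H0: "\<And>z. z \<in> topspace Z \<Longrightarrow> H (z, 0) = q (h z)"
  define k where "k = (\<lambda>z. (h z, \<lambda>s. H (z, s)))"
  have k: "continuous_map Z ?P k"
    unfolding k_def using Z h H H0 by (rule continuous_map_into_mapping_path_space)
  have "continuous_map (prod_topology Z ?I) Y (\<lambda>x. L (k (fst x), snd x))"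
    by (intro continuous_map_compose2[OF L] continuous_map_pairedI continuous_map_snd
        continuous_map_compose2[OF k continuous_map_fst])
  moreover have "L (k z, 0) = h z" "\<forall>s\<in>{0..1}. q (L (k z, s)) = H (z, s)" if "z \<in> topspace Z" for z
    using L0 qL continuous_map_image_subset_topspace[OF k] that
    by (auto simp: k_def image_subset_iff)
  ultimately show "\<exists>G. continuous_map (prod_topology Z ?I) Y G \<and> (\<forall>z\<in>topspace Z. G (z, 0) = h z) \<and>
      (\<forall>z\<in>topspace Z. \<forall>s\<in>{0..1}. q (G (z, s)) = H (z, s))"
    by (intro exI[of _ "\<lambda>x. L (k (fst x), snd x)"]) simp
qed (use fib in \<open>simp_all add: hurewicz_fibration_def\<close>)

section \<open>Cofibrations and retractions onto the mapping cylinder\<close>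

definition mapping_cylinder :: "'y topology \<Rightarrow> 'y set \<Rightarrow> ('y \<times> real) set" where
  "mapping_cylinder Y S = topspace Y \<times> {0} \<union> S \<times> {0..1}"

abbreviation mapping_cylinder_space :: "'y topology \<Rightarrow> 'y set \<Rightarrow> ('y \<times> real) topology" where
  "mapping_cylinder_space Y S \<equiv> subtopology (prod_topology Y unit_interval) (mapping_cylinder Y S)"

lemma mem_mapping_cylinder_iff:
  "(y, s) \<in> mapping_cylinder Y S \<longleftrightarrow> y \<in> topspace Y \<and> s = 0 \<or> y \<in> S \<and> s \<in> {0..1}"
  by (auto simp: mapping_cylinder_def)

lemma mapping_cylinder_subset_topspace:
  "S \<subseteq> topspace Y \<Longrightarrow> mapping_cylinder Y S \<subseteq> topspace (prod_topology Y unit_interval)"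
  by (auto simp: mapping_cylinder_def)

lemma closed_cofibration_imp_continuous_map: "closed_cofibration T B Y i \<Longrightarrow> continuous_map B Y i"
  unfolding closed_cofibration_def embedding_map_def
  by (elim conjE) (rule continuous_map_into_fulltopology[OF homeomorphic_imp_continuous_map])

lemma closed_cofibration_imp_closedin: "closed_cofibration T B Y i \<Longrightarrow> closedin Y (i ` topspace B)"
  by (simp add: closed_cofibration_def)

\<comment> \<open>Moves a target space \<open>Z\<close> to the type at which the homotopy extension property is assumed.\<close>
definition transported_topology :: "('z \<Rightarrow> 'w) \<Rightarrow> 'z topology \<Rightarrow> 'w topology" where
  "transported_topology j Z =
     kify (pullback_topology (j ` topspace Z) (inv_into (topspace Z) j) Z)"

lemma continuous_map_from_transported_topology:
  "continuous_map (transported_topology j Z) Z (inv_into (topspace Z) j)"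
  unfolding transported_topology_def using continuous_map_pullback[OF continuous_map_id[of Z]]
  by (intro continuous_map_from_kify) simp

lemma continuous_map_into_transported_topology:
  assumes j: "inj_on j (topspace Z)" and X: "kspace X" and g: "continuous_map X Z g"
  shows "continuous_map X (transported_topology j Z) (\<lambda>x. j (g x))"
  unfolding transported_topology_def continuous_map_into_kify_iff[OF X]
proof (rule continuous_map_pullback')
  have gZ: "g x \<in> topspace Z" if "x \<in> topspace X" for x
    using g that by (auto simp: continuous_map_def)
  show "continuous_map X Z (inv_into (topspace Z) j \<circ> (\<lambda>x. j (g x)))"
    by (rule continuous_map_eq[OF g]) (simp add: gZ j)
  show "topspace X \<subseteq> (\<lambda>x. j (g x)) -` j ` topspace Z"
    using gZ by auto
qed

lemma closed_cofibration_extend: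
  fixes B :: "'b topology" and Y :: "'y topology" and Z :: "'z topology" and j :: "'z \<Rightarrow> 'w"
  assumes cof: "closed_cofibration TYPE('w) B Y i" and j: "inj_on j (topspace Z)"
    and h: "continuous_map Y Z h" and H: "continuous_map (prod_topology B unit_interval) Z H"
    and H0: "\<And>b. b \<in> topspace B \<Longrightarrow> H (b, 0) = h (i b)"
  obtains G where "continuous_map (prod_topology Y unit_interval) Z G"
    and "\<And>y. y \<in> topspace Y \<Longrightarrow> G (y, 0) = h y"
    and "\<And>b s. b \<in> topspace B \<Longrightarrow> s \<in> {0..1} \<Longrightarrow> G (i b, s) = H (b, s)"
proof -
  have B: "kspace B" and Y: "kspace Y" using cof by (auto simp: closed_cofibration_def)
  let ?Z = "transported_topology j Z" and ?k = "inv_into (topspace Z) j"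
  have "kspace ?Z" by (simp add: transported_topology_def kspace_kify)
  moreover have "continuous_map Y ?Z (\<lambda>y. j (h y))"
    using j Y h by (rule continuous_map_into_transported_topology)
  moreover have "continuous_map (kprod B unit_interval) ?Z (\<lambda>x. j (H x))"
    unfolding kprod_unit_interval[OF B]
    using j kspace_prod_unit_interval[OF B] H by (rule continuous_map_into_transported_topology)
  moreover have "\<forall>b\<in>topspace B. j (H (b, 0)) = j (h (i b))"
    using H0 by simp
  ultimately have "\<exists>G. continuous_map (kprod Y unit_interval) ?Z G \<and>
      (\<forall>y\<in>topspace Y. G (y, 0) = j (h y)) \<and>
      (\<forall>b\<in>topspace B. \<forall>s\<in>{0..1}. G (i b, s) = j (H (b, s)))"
    using cof unfolding closed_cofibration_def by blast
  then obtain G where G: "continuous_map (kprod Y unit_interval) ?Z G"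
    and G0: "\<And>y. y \<in> topspace Y \<Longrightarrow> G (y, 0) = j (h y)"
    and GH: "\<And>b s. b \<in> topspace B \<Longrightarrow> s \<in> {0..1} \<Longrightarrow> G (i b, s) = j (H (b, s))"
    by blast
  have hZ: "h y \<in> topspace Z" if "y \<in> topspace Y" for y
    using h that by (auto simp: continuous_map_def)
  have HZ: "H (b, s) \<in> topspace Z" if "b \<in> topspace B" "s \<in> {0..1}" for b s
    using continuous_map_image_subset_topspace[OF H] that by auto
  show thesis
  proof (rule that)
    show "continuous_map (prod_topology Y unit_interval) Z (\<lambda>x. ?k (G x))"
      using continuous_map_compose2[OF continuous_map_from_transported_topology G]
      by (simp add: kprod_unit_interval Y)
  qed (simp_all add: G0 GH j hZ HZ del: atLeastAtMost_iff)
qed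

theorem closed_cofibration_imp_retract:
  fixes Y :: "'y topology" and B :: "'b topology"
  assumes cof: "closed_cofibration TYPE('y + 'b \<times> real) B Y i"
  shows "mapping_cylinder Y (i ` topspace B) retract_of_space prod_topology Y unit_interval"
proof -
  let ?M = "mapping_cylinder_space Y (i ` topspace B)"
  note i = closed_cofibration_imp_continuous_map[OF cof]
  have iY: "i ` topspace B \<subseteq> topspace Y"
    using i by (rule continuous_map_image_subset_topspace)
  define j where
    "j = (\<lambda>(y, s :: real). if s = 0 then Inl y else Inr (inv_into (topspace B) i y, s))"
  have "inj_on j (topspace ?M)"
  proof (rule inj_onI, clarify)
    fix y s y' s' assume "j (y, s) = j (y', s')"
      and "(y, s) \<in> topspace ?M" "(y', s') \<in> topspace ?M"
    then show "y = y' \<and> s = s'"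
      using inv_into_injective[of "topspace B" i y y']
      by (simp add: j_def mem_mapping_cylinder_iff split: if_splits)
  qed
  moreover have "continuous_map Y ?M (\<lambda>y. (y, 0))"
    by (auto simp: continuous_map_in_subtopology mem_mapping_cylinder_iff
        intro!: continuous_map_pairedI)
  moreover have "continuous_map (prod_topology B unit_interval) ?M (\<lambda>x. (i (fst x), snd x))"
    by (intro continuous_map_into_subtopology continuous_map_pairedI continuous_map_snd
        continuous_map_compose2[OF i continuous_map_fst]) (auto simp: mem_mapping_cylinder_iff)
  ultimately obtain r where r: "continuous_map (prod_topology Y unit_interval) ?M r"
    and r0: "\<And>y. y \<in> topspace Y \<Longrightarrow> r (y, 0) = (y, 0)"
    and ri: "\<And>b s. b \<in> topspace B \<Longrightarrow> s \<in> {0..1} \<Longrightarrow> r (i b, s) = (i b, s)"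
    by (rule closed_cofibration_extend[OF cof]) auto
  have "\<forall>x\<in>mapping_cylinder Y (i ` topspace B). r x = x"
    using r0 ri by (auto simp: mapping_cylinder_def)
  then show ?thesis
    unfolding retract_of_space_def using r mapping_cylinder_subset_topspace[OF iY] by blast
qed

lemma extension_from_mapping_cylinder:
  assumes i: "embedding_map B Y i" and clo: "closedin Y (i ` topspace B)"
    and h: "continuous_map Y Z h" and H: "continuous_map (prod_topology B unit_interval) Z H"
    and H0: "\<And>b. b \<in> topspace B \<Longrightarrow> H (b, 0) = h (i b)"
  obtains g where "continuous_map (mapping_cylinder_space Y (i ` topspace B)) Z g"
    and "\<And>y. y \<in> topspace Y \<Longrightarrow> g (y, 0) = h y"
    and "\<And>b s. b \<in> topspace B \<Longrightarrow> s \<in> {0..1} \<Longrightarrow> g (i b, s) = H (b, s)"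
proof -
  let ?B = "i ` topspace B" and ?M = "mapping_cylinder_space Y (i ` topspace B)"
  obtain p where p: "continuous_map (subtopology Y ?B) B p"
    and pi: "\<And>b. b \<in> topspace B \<Longrightarrow> p (i b) = b"
    using i unfolding embedding_map_def homeomorphic_map_maps homeomorphic_maps_def by blast
  have BY: "?B \<subseteq> topspace Y" using clo by (rule closedin_subset)
  have fst_M: "continuous_map ?M Y fst" and snd_M: "continuous_map ?M unit_interval snd"
    by (auto intro: continuous_map_from_subtopology continuous_map_fst continuous_map_snd)
  define S T where "S = {x \<in> topspace ?M. snd x = 0}" and "T = {x \<in> topspace ?M. fst x \<in> ?B}"
  define g where "g = (\<lambda>x. if x \<in> S then h (fst x) else H (p (fst x), snd x))"
  show thesis
  proof (rule that)
    show "continuous_map ?M Z g"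
      unfolding g_def
    proof (rule continuous_map_cases_closed[where T = T])
      show "closedin ?M S"
        unfolding S_def using snd_M by (rule closedin_unit_interval_zero_set)
      show "closedin ?M T"
        unfolding T_def using fst_M clo by (rule closedin_continuous_map_preimage)
      show "topspace ?M \<subseteq> S \<union> T"
        by (auto simp: S_def T_def mapping_cylinder_def)
      show "continuous_map (subtopology ?M S) Z (\<lambda>x. h (fst x))"
        by (intro continuous_map_from_subtopology continuous_map_compose2[OF h fst_M])
      have "continuous_map (subtopology ?M T) (subtopology Y ?B) fst"
        by (intro continuous_map_into_subtopology continuous_map_from_subtopology[OF fst_M])
          (auto simp: T_def)
      then show "continuous_map (subtopology ?M T) Z (\<lambda>x. H (p (fst x), snd x))"
        by (intro continuous_map_compose2[OF H] continuous_map_pairedI continuous_map_compose2[OF p]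
            continuous_map_from_subtopology[OF snd_M])
      show "h (fst x) = H (p (fst x), snd x)" if "x \<in> S" "x \<in> T" for x
        using that H0 pi by (auto simp: S_def T_def)
    qed
    show "g (y, 0) = h y" if "y \<in> topspace Y" for y
      using that by (simp add: g_def S_def mem_mapping_cylinder_iff)
    show "g (i b, s) = H (b, s)" if "b \<in> topspace B" "s \<in> {0..1}" for b s
      using that H0 pi BY by (auto simp: g_def S_def mem_mapping_cylinder_iff)
  qed
qed

theorem retract_imp_closed_cofibration:
  fixes Y :: "'y topology" and B :: "'b topology"
  assumes B: "kspace B" and Y: "kspace Y"
    and i: "embedding_map B Y i" and clo: "closedin Y (i ` topspace B)"
    and ret: "mapping_cylinder Y (i ` topspace B) retract_of_space prod_topology Y unit_interval"
  shows "closed_cofibration TYPE('w) B Y i"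
  unfolding closed_cofibration_def kprod_unit_interval[OF B] kprod_unit_interval[OF Y]
proof (intro conjI allI impI)
  let ?X = "prod_topology Y unit_interval" and ?M = "mapping_cylinder_space Y (i ` topspace B)"
  fix Z :: "'w topology" and h H
  assume "kspace Z \<and> continuous_map Y Z h \<and> continuous_map (prod_topology B unit_interval) Z H \<and>
    (\<forall>b\<in>topspace B. H (b, 0) = h (i b))"
  then obtain g where g: "continuous_map ?M Z g"
    and gh: "\<And>y. y \<in> topspace Y \<Longrightarrow> g (y, 0) = h y"
    and gH: "\<And>b s. b \<in> topspace B \<Longrightarrow> s \<in> {0..1} \<Longrightarrow> g (i b, s) = H (b, s)"
    using extension_from_mapping_cylinder[OF i clo] by metis
  obtain r where r: "continuous_map ?X ?M r"
    and r_id: "\<And>x. x \<in> mapping_cylinder Y (i ` topspace B) \<Longrightarrow> r x = x"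
    using ret by (auto simp: retract_of_space_def)
  have "continuous_map ?X Z (\<lambda>x. g (r x))"
    using g r by (rule continuous_map_compose2)
  moreover have "g (r (y, 0)) = h y" if "y \<in> topspace Y" for y
    using that gh r_id by (simp add: mem_mapping_cylinder_iff)
  moreover have "g (r (i b, s)) = H (b, s)" if "b \<in> topspace B" "s \<in> {0..1}" for b s
    using that gH r_id by (simp add: mem_mapping_cylinder_iff)
  ultimately show "\<exists>G. continuous_map ?X Z G \<and> (\<forall>y\<in>topspace Y. G (y, 0) = h y) \<and>
      (\<forall>b\<in>topspace B. \<forall>s\<in>{0..1}. G (i b, s) = H (b, s))"
    by blast
qed (simp_all add: assms)

\<comment> \<open>Strom's form of a closed cofibration, without the usual demand that the homotopy be
  stationary on \<open>S\<close>.\<close>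
definition Strom_structure :: "'y topology \<Rightarrow> 'y set \<Rightarrow> ('y \<Rightarrow> real) \<Rightarrow> ('y \<times> real \<Rightarrow> 'y) \<Rightarrow> bool" where
  "Strom_structure Y S u h \<longleftrightarrow>
     continuous_map Y unit_interval u \<and> continuous_map (prod_topology Y unit_interval) Y h \<and>
     (\<forall>y\<in>S. u y = 0) \<and> (\<forall>y\<in>topspace Y. h (y, 0) = y) \<and>
     (\<forall>y\<in>topspace Y. u y < 1 \<longrightarrow> h (y, u y) \<in> S)"

lemma mem_closed_at_left_endpoint:
  fixes a b :: real
  assumes f: "continuous_map unit_interval Y f" and S: "closedin Y S"
    and ab: "0 \<le> a" "a < b" "b \<le> 1" and fS: "\<And>s. a < s \<Longrightarrow> s < b \<Longrightarrow> f s \<in> S"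
  shows "f a \<in> S"
proof -
  have "closedin unit_interval {s \<in> topspace unit_interval. f s \<in> S}"
    using f S by (rule closedin_continuous_map_preimage)
  then have "closed {s \<in> {0..1}. f s \<in> S}"
    by (simp add: closedin_closed_eq)
  moreover have "{a<..<b} \<subseteq> {s \<in> {0..1}. f s \<in> S}"
    using ab fS by auto
  ultimately have "closure {a<..<b} \<subseteq> {s \<in> {0..1}. f s \<in> S}"
    by (rule closure_minimal[rotated])
  moreover have "a \<in> closure {a<..<b}" using ab by simp
  ultimately show ?thesis by blast
qed

lemma retract_imp_Strom_structure:
  fixes Y :: "'y topology"
  assumes S: "closedin Y S"
    and ret: "mapping_cylinder Y S retract_of_space prod_topology Y unit_interval"
  obtains u h where "Strom_structure Y S u h"
proof -
  let ?X = "prod_topology Y unit_interval"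
  obtain r where r: "continuous_map ?X (mapping_cylinder_space Y S) r"
    and r_id: "\<And>x. x \<in> mapping_cylinder Y S \<Longrightarrow> r x = x"
    using ret by (auto simp: retract_of_space_def)
  have rX: "continuous_map ?X ?X r" and rM: "\<And>x. x \<in> topspace ?X \<Longrightarrow> r x \<in> mapping_cylinder Y S"
    using r by (auto simp: continuous_map_in_subtopology)
  define d where "d = (\<lambda>x. \<bar>snd x - snd (r x)\<bar>)"
  have d: "continuous_map ?X euclideanreal d"
    unfolding d_def
    by (intro continuous_map_real_abs continuous_map_diff continuous_map_snd_unit_interval
        continuous_map_compose2[OF continuous_map_snd_unit_interval rX])
  obtain u where u_real: "continuous_map Y euclideanreal u"
    and u_attained: "\<And>y. y \<in> topspace Y \<Longrightarrow> \<exists>s\<in>topspace unit_interval. u y = d (y, s)"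
    and d_le_u: "\<And>y s. y \<in> topspace Y \<Longrightarrow> s \<in> topspace unit_interval \<Longrightarrow> d (y, s) \<le> u y"
    using continuous_fibrewise_maximum[OF compact_space_unit_interval _ d] by auto
  have "0 \<le> d x \<and> d x \<le> 1" if "x \<in> topspace ?X" for x
    using continuous_map_image_subset_topspace[OF rX] that by (fastforce simp: d_def)
  then have u: "continuous_map Y unit_interval u"
    using u_real u_attained by (fastforce simp: continuous_map_unit_interval_iff)
  have "u y = 0" if "y \<in> S" for y
    using u_attained[of y] that closedin_subset[OF S] r_id
    by (auto simp: d_def mem_mapping_cylinder_iff)
  moreover have h: "continuous_map ?X Y (\<lambda>x. fst (r x))"
    using continuous_map_fst rX by (rule continuous_map_compose2)
  moreover have "fst (r (y, u y)) \<in> S" if y: "y \<in> topspace Y" and "u y < 1" for y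
  proof (rule mem_closed_at_left_endpoint[OF continuous_map_slice_right[OF h y] S])
    show "0 \<le> u y" "u y < 1" using u y \<open>u y < 1\<close> by (auto simp: continuous_map_def)
    \<comment> \<open>Beyond time \<^term>\<open>u y\<close> the retraction has not moved the height \<open>s\<close> down to \<open>0\<close>.\<close>
    fix s assume s: "u y < s" "s < 1"
    then have s01: "s \<in> {0..1}" using \<open>0 \<le> u y\<close> by auto
    then have "\<bar>s - snd (r (y, s))\<bar> \<le> u y"
      using d_le_u[OF y] by (simp add: d_def)
    then have "snd (r (y, s)) \<noteq> 0" using s by auto
    then show "fst (r (y, s)) \<in> S"
      using rM[of "(y, s)"] y s01 by (auto simp: mapping_cylinder_def)
  qed simp
  ultimately have "Strom_structure Y S u (\<lambda>x. fst (r x))"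
    using u r_id by (auto simp: Strom_structure_def mem_mapping_cylinder_iff)
  then show thesis by (rule that)
qed

section \<open>The mapping cylinder of a section as a fibration\<close>

locale section_lifting_problem =
  fixes Z :: "'z topology" and Y :: "'y topology" and B :: "'b topology"
    and q :: "'y \<Rightarrow> 'b" and t :: "'b \<Rightarrow> 'y"
    and a :: "'z \<Rightarrow> 'y" and v :: "'z \<Rightarrow> real" and H :: "'z \<times> real \<Rightarrow> 'b"
  assumes fibration: "hurewicz_fibration TYPE('z) Y B q"
    and section_maps: "retraction_maps Y B q t"
    and closedin_section: "closedin Y (t ` topspace B)"
    and kspace_Z: "kspace Z"
    and continuous_map_a: "continuous_map Z Y a"
    and continuous_map_v: "continuous_map Z unit_interval v"
    and mem_cylinder: "z \<in> topspace Z \<Longrightarrow> (a z, v z) \<in> mapping_cylinder Y (t ` topspace B)"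
    and continuous_map_H: "continuous_map (prod_topology Z unit_interval) B H"
    and H_0: "z \<in> topspace Z \<Longrightarrow> H (z, 0) = q (a z)"
begin

abbreviation ZI :: "('z \<times> real) topology" where
  "ZI \<equiv> prod_topology Z unit_interval"

lemma continuous_map_t: "continuous_map B Y t"
  using section_maps by (simp add: retraction_maps_def)

lemma q_t: "b \<in> topspace B \<Longrightarrow> q (t b) = b"
  using section_maps by (simp add: retraction_maps_def)

lemma v_bounds: "z \<in> topspace Z \<Longrightarrow> 0 \<le> v z \<and> v z \<le> 1"
  using continuous_map_v by (simp add: continuous_map_unit_interval_iff)

lemma H_mem: "z \<in> topspace Z \<Longrightarrow> 0 \<le> s \<Longrightarrow> s \<le> 1 \<Longrightarrow> H (z, s) \<in> topspace B"
  using continuous_map_image_subset_topspace[OF continuous_map_H] by auto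

lemma continuous_map_v_fst: "continuous_map ZI unit_interval (\<lambda>x. v (fst x))"
  by (rule continuous_map_compose2[OF continuous_map_v continuous_map_fst])

\<comment> \<open>Where the point \<open>a z\<close> is when its height has dropped from \<open>v z\<close> to \<open>0\<close> at unit speed.\<close>
definition landing :: "'z \<Rightarrow> 'y" where
  "landing z = (if a z \<in> t ` topspace B then t (H (z, v z)) else a z)"

lemma q_landing: "z \<in> topspace Z \<Longrightarrow> q (landing z) = H (z, v z)"
  using mem_cylinder[of z] H_mem[of z "v z"] v_bounds[of z] q_t H_0[of z]
  by (auto simp: landing_def mem_mapping_cylinder_iff)

lemma continuous_map_landing: "continuous_map Z Y landing"
proof -
  define S T where "S = {z \<in> topspace Z. a z \<in> t ` topspace B}" and "T = {z \<in> topspace Z. v z = 0}"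
  have "continuous_map Z Y (\<lambda>z. if z \<in> S then t (H (z, v z)) else a z)"
  proof (rule continuous_map_cases_closed[where T = T])
    show "closedin Z S"
      unfolding S_def using continuous_map_a closedin_section
      by (rule closedin_continuous_map_preimage)
    show "closedin Z T"
      unfolding T_def using continuous_map_v by (rule closedin_unit_interval_zero_set)
    show "topspace Z \<subseteq> S \<union> T"
      using mem_cylinder by (auto simp: S_def T_def mem_mapping_cylinder_iff)
    show "continuous_map (subtopology Z S) Y (\<lambda>z. t (H (z, v z)))"
      by (intro continuous_map_from_subtopology continuous_map_compose2[OF continuous_map_t]
          continuous_map_compose2[OF continuous_map_H] continuous_map_pairedI continuous_map_v) simp
    show "continuous_map (subtopology Z T) Y a"
      using continuous_map_a by (rule continuous_map_from_subtopology)
    show "t (H (z, v z)) = a z" if "z \<in> S" "z \<in> T" for z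
      using that H_0[of z] q_t by (auto simp: S_def T_def)
  qed
  then show ?thesis
    by (rule continuous_map_eq) (simp add: S_def landing_def)
qed

lemma lift_from_landing:
  obtains G where "continuous_map ZI Y G"
    and "\<And>z. z \<in> topspace Z \<Longrightarrow> G (z, 0) = landing z"
    and "\<And>z s. z \<in> topspace Z \<Longrightarrow> s \<in> {0..1} \<Longrightarrow> q (G (z, s)) = H (z, min 1 (v z + s))"
proof -
  have "continuous_map ZI B (\<lambda>x. H (fst x, min 1 (v (fst x) + snd x)))"
    by (intro continuous_map_compose2[OF continuous_map_H] continuous_map_pairedI continuous_map_fst
        continuous_map_unit_interval_add continuous_map_v_fst continuous_map_snd)
  moreover have "H (fst (z, 0), min 1 (v (fst (z, 0)) + snd (z, 0))) = q (landing z)"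
    if "z \<in> topspace Z" for z
    using that v_bounds[of z] by (simp add: q_landing min_absorb2)
  ultimately show thesis
    by (rule hurewicz_fibration_lift[OF fibration kspace_Z continuous_map_landing])
      (use that in simp_all)
qed

definition descend_then_lift :: "('z \<times> real \<Rightarrow> 'y) \<Rightarrow> 'z \<times> real \<Rightarrow> 'y \<times> real" where
  "descend_then_lift G = (\<lambda>(z, s).
     (if a z \<in> t ` topspace B \<and> s \<le> v z then t (H (z, s)) else G (z, max 0 (s - v z)),
      max 0 (v z - s)))"

lemma continuous_map_fst_descend_then_lift:
  assumes G: "continuous_map ZI Y G" and G_0: "\<And>z. z \<in> topspace Z \<Longrightarrow> G (z, 0) = landing z"
  shows "continuous_map ZI Y (\<lambda>x. fst (descend_then_lift G x))"
proof -
  define S where "S = {x \<in> topspace ZI. a (fst x) \<in> t ` topspace B} \<inter>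
    {x \<in> topspace ZI. max 0 (snd x - v (fst x)) = 0}"
  define T where "T = {x \<in> topspace ZI. max 0 (v (fst x) - snd x) = 0}"
  have "continuous_map ZI Y (\<lambda>x. if x \<in> S then t (H x) else G (fst x, max 0 (snd x - v (fst x))))"
  proof (rule continuous_map_cases_closed[where T = T])
    show "closedin ZI S"
      unfolding S_def
      by (intro closedin_Int closedin_unit_interval_zero_set continuous_map_unit_interval_diff
          continuous_map_snd continuous_map_v_fst
          closedin_continuous_map_preimage[OF _ closedin_section]
          continuous_map_compose2[OF continuous_map_a continuous_map_fst])
    show "closedin ZI T"
      unfolding T_def
      by (intro closedin_unit_interval_zero_set continuous_map_unit_interval_diff
          continuous_map_snd continuous_map_v_fst)
    show "topspace ZI \<subseteq> S \<union> T"
      using mem_cylinder by (fastforce simp: S_def T_def mem_mapping_cylinder_iff)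
    show "continuous_map (subtopology ZI S) Y (\<lambda>x. t (H x))"
      by (intro continuous_map_from_subtopology
          continuous_map_compose2[OF continuous_map_t continuous_map_H])
    show "continuous_map (subtopology ZI T) Y (\<lambda>x. G (fst x, max 0 (snd x - v (fst x))))"
      by (intro continuous_map_from_subtopology continuous_map_compose2[OF G] continuous_map_pairedI
          continuous_map_fst continuous_map_unit_interval_diff continuous_map_snd
          continuous_map_v_fst)
    show "t (H x) = G (fst x, max 0 (snd x - v (fst x)))" if "x \<in> S" "x \<in> T" for x
      using that G_0 by (auto simp: S_def T_def landing_def max_def split: if_splits)
  qed
  then show ?thesis
    by (rule continuous_map_eq) (auto simp: descend_then_lift_def S_def max_def)
qed

lemma continuous_map_descend_then_lift:
  assumes "continuous_map ZI Y G" and "\<And>z. z \<in> topspace Z \<Longrightarrow> G (z, 0) = landing z"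
  shows "continuous_map ZI (mapping_cylinder_space Y (t ` topspace B)) (descend_then_lift G)"
proof (intro continuous_map_into_subtopology funcsetI)
  have fst: "continuous_map ZI Y (\<lambda>x. fst (descend_then_lift G x))"
    using assms by (rule continuous_map_fst_descend_then_lift)
  have snd: "snd (descend_then_lift G x) = max 0 (v (fst x) - snd x)" for x
    by (simp add: descend_then_lift_def case_prod_unfold)
  have "continuous_map ZI unit_interval (\<lambda>x. snd (descend_then_lift G x))"
    unfolding snd
    by (intro continuous_map_unit_interval_diff continuous_map_v_fst continuous_map_snd)
  with fst show "continuous_map ZI (prod_topology Y unit_interval) (descend_then_lift G)"
    by (simp add: continuous_map_pairwise o_def)
  fix x assume x: "x \<in> topspace ZI"
  obtain z s where zs: "x = (z, s)" "z \<in> topspace Z" "0 \<le> s" "s \<le> 1"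
    using x by auto
  show "descend_then_lift G x \<in> mapping_cylinder Y (t ` topspace B)"
  proof (cases "s < v z")
    case True
    then have "a z \<in> t ` topspace B"
      using mem_cylinder[of z] zs by (auto simp: mem_mapping_cylinder_iff)
    then show ?thesis
      using True zs H_mem[of z s] v_bounds[of z]
      by (simp add: descend_then_lift_def mem_mapping_cylinder_iff)
  next
    case False
    then have "snd (descend_then_lift G x) = 0" using snd[of x] zs by simp
    moreover have "fst (descend_then_lift G x) \<in> topspace Y"
      using continuous_map_image_subset_topspace[OF fst] x by auto
    ultimately show ?thesis by (simp add: mapping_cylinder_def mem_Times_iff)
  qed
qed

lemma lift_to_mapping_cylinder:
  obtains F where "continuous_map ZI (mapping_cylinder_space Y (t ` topspace B)) F"
    and "\<And>z. z \<in> topspace Z \<Longrightarrow> F (z, 0) = (a z, v z)"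
    and "\<And>z s. z \<in> topspace Z \<Longrightarrow> s \<in> {0..1} \<Longrightarrow> q (fst (F (z, s))) = H (z, s)"
proof -
  obtain G where G: "continuous_map ZI Y G" "\<And>z. z \<in> topspace Z \<Longrightarrow> G (z, 0) = landing z"
    and q_G: "\<And>z s. z \<in> topspace Z \<Longrightarrow> s \<in> {0..1} \<Longrightarrow> q (G (z, s)) = H (z, min 1 (v z + s))"
    using lift_from_landing by blast
  show thesis
  proof (rule that)
    show "continuous_map ZI (mapping_cylinder_space Y (t ` topspace B)) (descend_then_lift G)"
      using G by (rule continuous_map_descend_then_lift)
    fix z assume z: "z \<in> topspace Z"
    show "descend_then_lift G (z, 0) = (a z, v z)"
      using z v_bounds[of z] mem_cylinder[of z] G(2)[of z] H_0[of z] q_t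
      by (auto simp: descend_then_lift_def landing_def mem_mapping_cylinder_iff)
    fix s :: real assume s: "s \<in> {0..1}"
    show "q (fst (descend_then_lift G (z, s))) = H (z, s)"
    proof (cases "a z \<in> t ` topspace B \<and> s \<le> v z")
      case True
      then show ?thesis using z s H_mem[of z s] q_t by (simp add: descend_then_lift_def)
    next
      case False
      then have "v z \<le> s"
        using z s mem_cylinder[of z] by (auto simp: mem_mapping_cylinder_iff)
      then show ?thesis
        using False z s v_bounds[of z] q_G[of z "s - v z"] by (auto simp: descend_then_lift_def)
    qed
  qed
qed

end

section \<open>Fibrewise retractions\<close>

definition fibrewise_retraction ::
    "'y topology \<Rightarrow> 'y set \<Rightarrow> ('y \<Rightarrow> 'b) \<Rightarrow> ('y \<times> real \<Rightarrow> 'y \<times> real) \<Rightarrow> bool" where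
  "fibrewise_retraction Y S q \<rho> \<longleftrightarrow>
     continuous_map (prod_topology Y unit_interval) (mapping_cylinder_space Y S) \<rho> \<and>
     (\<forall>z\<in>mapping_cylinder Y S. \<rho> z = z) \<and>
     (\<forall>z\<in>topspace (prod_topology Y unit_interval). q (fst (\<rho> z)) = q (fst z))"

definition stopping_time :: "('y \<Rightarrow> real) \<Rightarrow> 'y \<times> real \<Rightarrow> real" where
  "stopping_time u z = min (snd z) (u (fst z))"

lemma continuous_map_stopping_time:
  assumes "continuous_map Y unit_interval u"
  shows "continuous_map (prod_topology Y unit_interval) unit_interval (stopping_time u)"
  unfolding stopping_time_def
  by (intro continuous_map_unit_interval_min continuous_map_snd
      continuous_map_compose2[OF assms continuous_map_fst])

lemma Strom_structure_mem_mapping_cylinder: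
  assumes strom: "Strom_structure Y S u h" and z: "z \<in> topspace (prod_topology Y unit_interval)"
  shows "(h (fst z, stopping_time u z), max 0 (snd z - u (fst z))) \<in> mapping_cylinder Y S"
proof -
  have u: "0 \<le> u (fst z)" "u (fst z) \<le> 1" and h: "h z \<in> topspace Y"
    using strom z continuous_map_image_subset_topspace[of _ Y h]
    by (auto simp: Strom_structure_def continuous_map_unit_interval_iff image_subset_iff)
  show ?thesis
  proof (cases "snd z \<le> u (fst z)")
    case True
    then show ?thesis using h by (simp add: stopping_time_def mem_mapping_cylinder_iff)
  next
    case False
    then show ?thesis
      using strom z u by (auto simp: Strom_structure_def stopping_time_def mem_mapping_cylinder_iff)
  qed
qed

lemma Strom_structure_lift_reversed_deformation:
  fixes Y :: "'y topology" and B :: "'b topology"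
  assumes fib: "hurewicz_fibration TYPE('y \<times> real) Y B q" and sec: "retraction_maps Y B q t"
    and clo: "closedin Y (t ` topspace B)" and strom: "Strom_structure Y (t ` topspace B) u h"
  obtains F where "continuous_map (prod_topology (prod_topology Y unit_interval) unit_interval)
      (mapping_cylinder_space Y (t ` topspace B)) F"
    and "\<And>z. z \<in> topspace (prod_topology Y unit_interval) \<Longrightarrow>
      F (z, 0) = (h (fst z, stopping_time u z), max 0 (snd z - u (fst z)))"
    and "\<And>z s. z \<in> topspace (prod_topology Y unit_interval) \<Longrightarrow> s \<in> {0..1} \<Longrightarrow>
      q (fst (F (z, s))) = q (h (fst z, max 0 (stopping_time u z - s)))"
proof -
  let ?I = unit_interval and ?X = "prod_topology Y unit_interval"
  have Y: "kspace Y" and q: "continuous_map Y B q"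
    using fib by (simp_all add: hurewicz_fibration_def)
  have u: "continuous_map Y ?I u" and h: "continuous_map ?X Y h"
    using strom by (simp_all add: Strom_structure_def)
  note stop = continuous_map_stopping_time[OF u]
  interpret section_lifting_problem ?X Y B q t "\<lambda>z. h (fst z, stopping_time u z)"
    "\<lambda>z. max 0 (snd z - u (fst z))"
    "\<lambda>x. q (h (fst (fst x), max 0 (stopping_time u (fst x) - snd x)))"
  proof unfold_locales
    show "continuous_map ?X Y (\<lambda>z. h (fst z, stopping_time u z))"
      by (intro continuous_map_compose2[OF h] continuous_map_pairedI continuous_map_fst stop)
    show "continuous_map ?X ?I (\<lambda>z. max 0 (snd z - u (fst z)))"
      by (intro continuous_map_unit_interval_diff continuous_map_snd
          continuous_map_compose2[OF u continuous_map_fst])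
    show "continuous_map (prod_topology ?X ?I) B
        (\<lambda>x. q (h (fst (fst x), max 0 (stopping_time u (fst x) - snd x))))"
      by (intro continuous_map_compose2[OF q] continuous_map_compose2[OF h] continuous_map_pairedI
          continuous_map_unit_interval_diff continuous_map_snd
          continuous_map_compose2[OF continuous_map_fst continuous_map_fst]
          continuous_map_compose2[OF stop continuous_map_fst])
    show "q (h (fst (fst (z, 0)), max 0 (stopping_time u (fst (z, 0)) - snd (z, 0)))) =
        q (h (fst z, stopping_time u z))" if "z \<in> topspace ?X" for z
      using stop that by (auto simp: continuous_map_unit_interval_iff)
  qed (use fib sec clo kspace_prod_unit_interval[OF Y]
      Strom_structure_mem_mapping_cylinder[OF strom] in auto)
  show thesis
    using lift_to_mapping_cylinder that by (metis fst_conv snd_conv)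
qed

lemma Strom_structure_imp_fibrewise_retraction:
  fixes Y :: "'y topology" and B :: "'b topology"
  assumes fib: "hurewicz_fibration TYPE('y \<times> real) Y B q" and sec: "retraction_maps Y B q t"
    and clo: "closedin Y (t ` topspace B)" and strom: "Strom_structure Y (t ` topspace B) u h"
  obtains \<rho> where "fibrewise_retraction Y (t ` topspace B) q \<rho>"
proof -
  let ?I = unit_interval and ?X = "prod_topology Y unit_interval" and ?S = "t ` topspace B"
  have u: "continuous_map Y ?I u"
    and u_0: "\<And>y. y \<in> ?S \<Longrightarrow> u y = 0" and h_0: "\<And>y. y \<in> topspace Y \<Longrightarrow> h (y, 0) = y"
    using strom by (auto simp: Strom_structure_def)
  note stop = continuous_map_stopping_time[OF u]
  obtain F where F: "continuous_map (prod_topology ?X ?I) (mapping_cylinder_space Y ?S) F"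
    and F_0: "\<And>z. z \<in> topspace ?X \<Longrightarrow>
      F (z, 0) = (h (fst z, stopping_time u z), max 0 (snd z - u (fst z)))"
    and q_F: "\<And>z s. z \<in> topspace ?X \<Longrightarrow> s \<in> {0..1} \<Longrightarrow>
      q (fst (F (z, s))) = q (h (fst z, max 0 (stopping_time u z - s)))"
    using Strom_structure_lift_reversed_deformation[OF fib sec clo strom] by blast
  have "continuous_map ?X (mapping_cylinder_space Y ?S) (\<lambda>z. F (z, stopping_time u z))"
    by (intro continuous_map_compose2[OF F] continuous_map_pairedI stop) simp
  moreover have "F (z, stopping_time u z) = z" if z: "z \<in> mapping_cylinder Y ?S" for z
  proof -
    have zX: "z \<in> topspace ?X"
      using z mapping_cylinder_subset_topspace[OF closedin_subset[OF clo]] by blast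
    then have "stopping_time u z = 0" "max 0 (snd z - u (fst z)) = snd z"
      using z u_0 u
      by (auto simp: stopping_time_def mapping_cylinder_def continuous_map_unit_interval_iff)
    then show ?thesis using F_0[OF zX] zX h_0 by auto
  qed
  moreover have "q (fst (F (z, stopping_time u z))) = q (fst z)" if "z \<in> topspace ?X" for z
    using q_F[OF that] h_0 that stop by (auto simp: continuous_map_unit_interval_iff)
  ultimately show thesis
    by (intro that) (auto simp: fibrewise_retraction_def)
qed

section \<open>Pullbacks\<close>

lemma topspace_pullback_space:
  "topspace (pullback_space Y A q f) = {(y, a). y \<in> topspace Y \<and> a \<in> topspace A \<and> q y = f a}"
  by (auto simp: pullback_space_def kprod_def)

lemma kspace_pullback_space: "kspace (pullback_space Y A q f)"
  by (simp add: pullback_space_def kspace_kify)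

lemma continuous_map_pullback_space_fst: "continuous_map (pullback_space Y A q f) Y fst"
  and continuous_map_pullback_space_snd: "continuous_map (pullback_space Y A q f) A snd"
  unfolding pullback_space_def kprod_def
  by (intro continuous_map_from_kify continuous_map_from_subtopology
      continuous_map_fst continuous_map_snd)+

lemma continuous_map_into_pullback_space:
  assumes "kspace Z" "continuous_map Z Y u" "continuous_map Z A v"
    and "\<And>z. z \<in> topspace Z \<Longrightarrow> q (u z) = f (v z)"
  shows "continuous_map Z (pullback_space Y A q f) (\<lambda>z. (u z, v z))"
  unfolding pullback_space_def kprod_def continuous_map_into_kify_iff[OF assms(1)]
proof (rule continuous_map_into_subtopology)
  show "continuous_map Z (kify (prod_topology Y A)) (\<lambda>z. (u z, v z))"
    using assms by (simp add: continuous_map_into_kify_iff continuous_map_pairedI)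
  show "(\<lambda>z. (u z, v z)) \<in> topspace Z \<rightarrow> {(y, a). y \<in> topspace Y \<and> a \<in> topspace A \<and> q y = f a}"
    using assms by (auto simp: continuous_map_def)
qed

lemma hurewicz_fibration_pullback_space:
  fixes Y :: "'y topology" and B :: "'b topology" and A :: "'a topology"
  assumes fib: "hurewicz_fibration TYPE('z) Y B q"
    and A: "kspace A" and f: "continuous_map A B f"
  shows "hurewicz_fibration TYPE('z) (pullback_space Y A q f) A snd"
proof (rule hurewicz_fibrationI[OF kspace_pullback_space A continuous_map_pullback_space_snd])
  let ?E = "pullback_space Y A q f" and ?I = unit_interval
  fix Z :: "'z topology" and h H
  assume Z: "kspace Z" and h: "continuous_map Z ?E h"
    and H: "continuous_map (prod_topology Z ?I) A H"
    and H0: "\<And>z. z \<in> topspace Z \<Longrightarrow> H (z, 0) = snd (h z)"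
  have "f (H (z, 0)) = q (fst (h z))" if "z \<in> topspace Z" for z
    using continuous_map_image_subset_topspace[OF h] H0 that by (auto simp: topspace_pullback_space)
  then obtain G where G: "continuous_map (prod_topology Z ?I) Y G"
    and G0: "\<And>z. z \<in> topspace Z \<Longrightarrow> G (z, 0) = fst (h z)"
    and qG: "\<And>z s. z \<in> topspace Z \<Longrightarrow> s \<in> {0..1} \<Longrightarrow> q (G (z, s)) = f (H (z, s))"
    using hurewicz_fibration_lift[OF fib Z
        continuous_map_compose2[OF continuous_map_pullback_space_fst h]
        continuous_map_compose2[OF f H]] by blast
  have "continuous_map (prod_topology Z ?I) ?E (\<lambda>x. (G x, H x))"
    using G H qG by (intro continuous_map_into_pullback_space kspace_prod_unit_interval[OF Z]) auto
  then show "\<exists>G. continuous_map (prod_topology Z ?I) ?E G \<and> (\<forall>z\<in>topspace Z. G (z, 0) = h z) \<and>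
      (\<forall>z\<in>topspace Z. \<forall>s\<in>{0..1}. snd (G (z, s)) = H (z, s))"
    using G0 H0 by (intro exI[of _ "\<lambda>x. (G x, H x)"]) auto
qed

lemma retraction_maps_pullback_space:
  assumes A: "kspace A" and sec: "retraction_maps Y B q t" and f: "continuous_map A B f"
  shows "retraction_maps (pullback_space Y A q f) A snd (\<lambda>a. (t (f a), a))"
proof -
  have "continuous_map B Y t" and "\<And>a. a \<in> topspace A \<Longrightarrow> q (t (f a)) = f a"
    using sec f by (auto simp: retraction_maps_def continuous_map_def)
  then show ?thesis
    unfolding retraction_maps_def
    using A f by (auto intro!: continuous_map_into_pullback_space continuous_map_pullback_space_snd
        intro: continuous_map_compose2)
qed

lemma image_pullback_section:
  assumes sec: "retraction_maps Y B q t" and f: "continuous_map A B f"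
  shows "(\<lambda>a. (t (f a), a)) ` topspace A =
    {x \<in> topspace (pullback_space Y A q f). fst x \<in> t ` topspace B}"
  using assms by (auto simp: topspace_pullback_space retraction_maps_def continuous_map_def)

lemma retract_mapping_cylinder_pullback_space:
  fixes Y :: "'y topology" and A :: "'a topology"
  assumes "fibrewise_retraction Y S q \<rho>"
  shows "mapping_cylinder (pullback_space Y A q f)
      {x \<in> topspace (pullback_space Y A q f). fst x \<in> S}
    retract_of_space prod_topology (pullback_space Y A q f) unit_interval"
proof -
  let ?E = "pullback_space Y A q f" and ?X = "prod_topology (pullback_space Y A q f) unit_interval"
  let ?S = "{x \<in> topspace ?E. fst x \<in> S}"
  have \<rho>: "continuous_map (prod_topology Y unit_interval) (mapping_cylinder_space Y S) \<rho>"
    and \<rho>_id: "\<And>z. z \<in> mapping_cylinder Y S \<Longrightarrow> \<rho> z = z"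
    and \<rho>_q: "\<And>z. z \<in> topspace (prod_topology Y unit_interval) \<Longrightarrow> q (fst (\<rho> z)) = q (fst z)"
    using assms by (auto simp: fibrewise_retraction_def)
  define \<pi> where "\<pi> = (\<lambda>x :: ('y \<times> 'a) \<times> real. (fst (fst x), snd x))"
  define R where "R = (\<lambda>x. ((fst (\<rho> (\<pi> x)), snd (fst x)), snd (\<rho> (\<pi> x))))"
  have \<pi>: "continuous_map ?X (prod_topology Y unit_interval) \<pi>"
    unfolding \<pi>_def by (intro continuous_map_pairedI continuous_map_snd
        continuous_map_compose2[OF continuous_map_pullback_space_fst continuous_map_fst])
  have \<rho>\<pi>: "continuous_map ?X (prod_topology Y unit_interval) (\<lambda>x. \<rho> (\<pi> x))"
    and \<rho>\<pi>_M: "\<And>x. x \<in> topspace ?X \<Longrightarrow> \<rho> (\<pi> x) \<in> mapping_cylinder Y S"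
    using continuous_map_compose2[OF \<rho> \<pi>] by (auto simp: continuous_map_in_subtopology)
  have "continuous_map ?X ?E (\<lambda>x. (fst (\<rho> (\<pi> x)), snd (fst x)))"
  proof (rule continuous_map_into_pullback_space)
    show "q (fst (\<rho> (\<pi> x))) = f (snd (fst x))" if "x \<in> topspace ?X" for x
      using that \<rho>_q by (auto simp: \<pi>_def topspace_pullback_space)
  qed (auto intro: kspace_prod_unit_interval kspace_pullback_space
      continuous_map_compose2[OF continuous_map_fst \<rho>\<pi>]
      continuous_map_compose2[OF continuous_map_pullback_space_snd continuous_map_fst])
  then have R: "continuous_map ?X ?X R"
    unfolding R_def
    by (intro continuous_map_pairedI continuous_map_compose2[OF continuous_map_snd \<rho>\<pi>])
  moreover have "R x \<in> mapping_cylinder ?E ?S" if x: "x \<in> topspace ?X" for x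
    using \<rho>\<pi>_M[OF x] continuous_map_image_subset_topspace[OF R] x
    by (auto simp: R_def mapping_cylinder_def)
  moreover have "R x = x" if "x \<in> mapping_cylinder ?E ?S" for x
  proof -
    have "\<pi> x \<in> mapping_cylinder Y S"
      using that by (auto simp: \<pi>_def mapping_cylinder_def topspace_pullback_space)
    then show ?thesis using \<rho>_id by (simp add: R_def \<pi>_def)
  qed
  moreover have "mapping_cylinder ?E ?S \<subseteq> topspace ?X"
    by (rule mapping_cylinder_subset_topspace) blast
  ultimately show ?thesis
    unfolding retract_of_space_def by (blast intro: continuous_map_into_subtopology)
qed

lemma closed_cofibration_pullback_section:
  fixes Y :: "'y topology" and B :: "'b topology" and A :: "'a topology"
  assumes A: "kspace A" and sec: "retraction_maps Y B q t" and f: "continuous_map A B f"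
    and clo: "closedin Y (t ` topspace B)" and ret: "fibrewise_retraction Y (t ` topspace B) q \<rho>"
  shows "closed_cofibration TYPE('w) A (pullback_space Y A q f) (\<lambda>a. (t (f a), a))"
proof (rule retract_imp_closed_cofibration[OF A kspace_pullback_space])
  let ?E = "pullback_space Y A q f" and ?\<sigma> = "\<lambda>a. (t (f a), a)"
  show "embedding_map A ?E ?\<sigma>"
    using retraction_maps_pullback_space[OF A sec f]
    by (intro section_imp_embedding_map) (auto simp: section_map_def)
  show "closedin ?E (?\<sigma> ` topspace A)"
    unfolding image_pullback_section[OF sec f]
    using continuous_map_pullback_space_fst clo by (rule closedin_continuous_map_preimage)
  show "mapping_cylinder ?E (?\<sigma> ` topspace A) retract_of_space prod_topology ?E unit_interval"
    unfolding image_pullback_section[OF sec f]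
    using ret by (rule retract_mapping_cylinder_pullback_space)
qed

theorem theorem16:
  fixes A :: "'a topology" and B :: "'b topology" and Y :: "'y topology"
    and q :: "'y \<Rightarrow> 'b" and t :: "'b \<Rightarrow> 'y" and f :: "'a \<Rightarrow> 'b"
  assumes "kspace A" and "kspace B" and "kspace Y"
    and "weak_Hausdorff B"
    and "hurewicz_fibration TYPE('y \<times> (real \<Rightarrow> 'b)) Y B q"
    and "retraction_maps Y B q t"
    and "closed_cofibration TYPE('y + 'b \<times> real) B Y t"
    and "continuous_map A B f"
  shows "hurewicz_fibration TYPE('z) (pullback_space Y A q f) A snd \<and>
         retraction_maps (pullback_space Y A q f) A snd (\<lambda>a. (t (f a), a)) \<and>
         closed_cofibration TYPE('w) A (pullback_space Y A q f) (\<lambda>a. (t (f a), a))"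
proof (intro conjI)
  note A = assms(1) and sec = assms(6) and cof = assms(7) and f = assms(8)
  note fib = hurewicz_fibration_all_types[OF assms(5)]
  show "hurewicz_fibration TYPE('z) (pullback_space Y A q f) A snd"
    using fib A f by (rule hurewicz_fibration_pullback_space)
  show "retraction_maps (pullback_space Y A q f) A snd (\<lambda>a. (t (f a), a))"
    using A sec f by (rule retraction_maps_pullback_space)
  note clo = closed_cofibration_imp_closedin[OF cof]
  obtain u h where "Strom_structure Y (t ` topspace B) u h"
    using clo closed_cofibration_imp_retract[OF cof] by (rule retract_imp_Strom_structure)
  then obtain \<rho> where "fibrewise_retraction Y (t ` topspace B) q \<rho>"
    by (rule Strom_structure_imp_fibrewise_retraction[OF fib sec clo])
  then show "closed_cofibration TYPE('w) A (pullback_space Y A q f) (\<lambda>a. (t (f a), a))"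
    by (rule closed_cofibration_pullback_section[OF A sec f clo])
qed

end
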